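(* Let $A=\langle a,b\mid\ \rangle$ be the free group of rank two and $C\le A$ the subgroup generated by $\alpha_1,\dots,\alpha_m$, where $m\ge8$, $s\ge10$, $\alpha_i=a^{k_{i1}^{(1)}}b^{k_{i1}^{(2)}}\cdots a^{k_{is}^{(1)}}b^{k_{is}^{(2)}}$ with nonzero integers $k_{ij}^{(t)}$ satisfying conditions (A), (B), (C) below. Then $C$ is relatively torsion-free in $A$. (A) for each $t\in\{1,2\}$, the $sm+\binom m2$ numbers $|k_{ij}^{(t)}|$ ($1\le i\le m,1\le j\le s$) together with $|k_{i1}^{(1)}-k_{i'1}^{(1)}|$ ($i<i'$) when $t=1$, resp. $|k_{is}^{(2)}-k_{i's}^{(2)}|$ ($i<i'$) when $t=2$, are pairwise distinct; (B) for $i\le 8$ and $t\in\{1,2\}$ the integers $k_{i1}^{(t)},\dots,k_{is}^{(t)}$ have a common sign $\epsilon_{it}$; (C) $\epsilon_{i1}=\epsilon_{i2}=1$ for $i\le4$ and $\epsilon_{i1}=-\epsilon_{i2}=1$ for $5\le i\le 8$.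
   Context: A subgroup $H$ of a group $G$ is relatively torsion-free (RTF) if for every $g\in G\setminus H$, every $k\ge1$ and all $h_1,\dots,h_k\in H$, one has $gh_1gh_2\cdots gh_k\neq1$. *)

theory Defs
  imports "HOL-Algebra.Algebra"
begin

text \<open>The free group of rank two on generators a, b, realised as reduced words.
A letter is a pair (g, e): g = False means generator a, g = True means b;
e = True means the inverse of that generator.\<close>

type_synonym letter = "bool \<times> bool"

definition linv :: "letter \<Rightarrow> letter" where
  "linv x = (fst x, \<not> snd x)"

fun reduce :: "letter list \<Rightarrow> letter list" where
  "reduce [] = []"
| "reduce (x # xs) =
     (case reduce xs of [] \<Rightarrow> [x]
      | y # ys \<Rightarrow> (if y = linv x then ys else x # y # ys))"

fun is_reduced :: "letter list \<Rightarrow> bool" where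
  "is_reduced [] = True"
| "is_reduced [x] = True"
| "is_reduced (x # y # ys) = (y \<noteq> linv x \<and> is_reduced (y # ys))"

definition F2 :: "letter list monoid" where
  "F2 = \<lparr> carrier = {w. is_reduced w}, monoid.mult = (\<lambda>u v. reduce (u @ v)), one = [] \<rparr>"

definition gen_pow :: "bool \<Rightarrow> int \<Rightarrow> letter list" where
  "gen_pow g k = replicate (nat \<bar>k\<bar>) (g, k < 0)"

definition alpha :: "(nat \<Rightarrow> nat \<Rightarrow> int) \<Rightarrow> (nat \<Rightarrow> nat \<Rightarrow> int) \<Rightarrow> nat \<Rightarrow> nat \<Rightarrow> letter list" where
  "alpha k1 k2 s i = reduce (concat (map (\<lambda>j. gen_pow False (k1 i j) @ gen_pow True (k2 i j)) [1..<Suc s]))"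

definition RTF :: "('a, 'b) monoid_scheme \<Rightarrow> 'a set \<Rightarrow> bool" where
  "RTF G H \<longleftrightarrow> (\<forall>g \<in> carrier G - H. \<forall>k::nat. k \<ge> 1 \<longrightarrow>
     (\<forall>h. (\<forall>i\<in>{1..k}. h i \<in> H) \<longrightarrow>
        foldr (\<lambda>i acc. g \<otimes>\<^bsub>G\<^esub> h i \<otimes>\<^bsub>G\<^esub> acc) [1..<Suc k] \<one>\<^bsub>G\<^esub> \<noteq> \<one>\<^bsub>G\<^esub>))"

end

theory Submission
  imports Defs
begin

text \<open>The core of the Schreier graph of \<open>C\<close> consists of \<open>a\<close>-lines and \<open>b\<close>-lines, glued at
junctions, with the base vertex \<open>B\<close> among them. Condition (A) enters only as follows: a nonzero
displacement between two junctions on a common line determines the two junctions; moreover an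
\<open>a\<close>-line meets each \<open>b\<close>-line at most once. Extending every line to a copy of the integers does
not change the closed paths.

For \<open>g\<close> outside \<open>C\<close> write \<open>g = p w q\<inverse>\<close> with \<open>p\<close>, \<open>q\<close> readable from \<open>B\<close>, ending at \<open>P\<close>, \<open>Q\<close>,
and with \<open>w\<close> as short as possible. Up to conjugation, a product of factors \<open>g h\<close> with \<open>h\<close> in \<open>C\<close> is a product
of factors \<open>w u\<close>, where \<open>u\<close> labels a path from \<open>Q\<close> to \<open>P\<close>. If \<open>w\<close> is nontrivial,
it cannot be absorbed by the graph at either end, so nothing cancels except between consecutive
copies of \<open>w\<close>. If \<open>w = 1\<close> then \<open>P \<noteq> Q\<close>, and \<open>P\<close>, \<open>Q\<close> may be moved simultaneously. A cancellation
between two consecutive paths lets a full segment ending at one junction meet a full segment leaving a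
different junction; by uniqueness of displacements these two never cancel completely, so
the cancellation stops there and some syllable of each long path survives.\<close>

section \<open>The free group on two generators\<close>

definition push :: "letter \<Rightarrow> letter list \<Rightarrow> letter list" where
  "push x w = (case w of [] \<Rightarrow> [x] | y # ys \<Rightarrow> (if y = linv x then ys else x # y # ys))"

lemma linv_linv [simp]: "linv (linv x) = x"
  by (simp add: linv_def)

lemma linv_neq [simp]: "linv x \<noteq> x" "x \<noteq> linv x"
  by (simp_all add: linv_def prod_eq_iff)

lemma reduce_Cons: "reduce (x # xs) = push x (reduce xs)"
  by (simp add: push_def)

lemma is_reduced_Cons: "is_reduced (x # xs) \<longleftrightarrow> is_reduced xs \<and> (xs = [] \<or> hd xs \<noteq> linv x)"
  by (cases xs) auto

lemma is_reduced_append: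
  "is_reduced (xs @ ys) \<longleftrightarrow>
     is_reduced xs \<and> is_reduced ys \<and> (xs = [] \<or> ys = [] \<or> hd ys \<noteq> linv (last xs))"
  by (induction xs) (auto simp: is_reduced_Cons)

lemma is_reduced_push: "is_reduced w \<Longrightarrow> is_reduced (push x w)"
  by (auto simp: push_def is_reduced_Cons split: list.split)

lemma is_reduced_reduce [simp]: "is_reduced (reduce w)"
  by (induction w) (simp_all only: reduce_Cons is_reduced_push reduce.simps is_reduced.simps)

lemma reduce_id: "is_reduced w \<Longrightarrow> reduce w = w"
  by (induction w) (auto simp: is_reduced_Cons split: list.split)

text \<open>Each letter acts on reduced words by a permutation, with \<open>linv x\<close> acting as
  the inverse of \<open>x\<close>. Hence a word may be reduced before it is made to act, which
  yields associativity of \<open>F2\<close>.\<close>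

lemma push_push: "is_reduced w \<Longrightarrow> push x (push (linv x) w) = w"
  by (cases w) (auto simp: push_def is_reduced_Cons split: list.split)

lemma reduce_append: "reduce (u @ v) = foldr push u (reduce v)"
  by (induction u) (simp_all add: reduce_Cons del: reduce.simps(2))

lemma is_reduced_foldr_push: "is_reduced r \<Longrightarrow> is_reduced (foldr push u r)"
  by (induction u) (simp_all add: is_reduced_push)

lemma foldr_push_push:
  assumes "is_reduced r"
  shows "foldr push (push x w) r = push x (foldr push w r)"
proof (cases w)
  case (Cons y ys)
  then show ?thesis
    using push_push[OF is_reduced_foldr_push[OF assms, of ys], of x] by (simp add: push_def[of x "y # ys"])
qed (simp add: push_def)

lemma foldr_push_reduce: "is_reduced r \<Longrightarrow> foldr push (reduce u) r = foldr push u r"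
  by (induction u) (simp_all add: reduce_Cons foldr_push_push del: reduce.simps(2))

lemma reduce_reduce_append [simp]: "reduce (reduce u @ v) = reduce (u @ v)"
  by (simp add: reduce_append foldr_push_reduce)

lemma reduce_append_reduce [simp]: "reduce (u @ reduce v) = reduce (u @ v)"
  by (simp add: reduce_append reduce_id)

lemma reduce_inverse: "reduce (rev (map linv w) @ w) = []"
proof (induction w)
  case (Cons x w)
  have "reduce (rev (map linv (x # w)) @ x # w)
      = foldr push (rev (map linv w)) (push (linv x) (push (linv (linv x)) (reduce w)))"
    by (simp add: reduce_append reduce_Cons del: reduce.simps(2))
  also have "\<dots> = reduce (rev (map linv w) @ w)"
    using push_push[of "reduce w" "linv x"] by (simp only: reduce_append is_reduced_reduce)
  finally show ?case
    using Cons.IH by simp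
qed simp

lemma carrier_F2: "w \<in> carrier F2 \<longleftrightarrow> is_reduced w"
  by (simp add: F2_def)

lemma mult_F2: "u \<otimes>\<^bsub>F2\<^esub> v = reduce (u @ v)"
  by (simp add: F2_def)

lemma one_F2: "\<one>\<^bsub>F2\<^esub> = []"
  by (simp add: F2_def)

interpretation F2: group F2
proof (rule groupI)
  fix x assume "x \<in> carrier F2"
  show "\<exists>y\<in>carrier F2. y \<otimes>\<^bsub>F2\<^esub> x = \<one>\<^bsub>F2\<^esub>"
    by (rule bexI[of _ "reduce (rev (map linv x))"])
       (simp_all add: mult_F2 one_F2 carrier_F2 reduce_inverse)
qed (simp_all add: carrier_F2 mult_F2 one_F2 reduce_id)

abbreviation F2_mult :: "letter list \<Rightarrow> letter list \<Rightarrow> letter list" (infixr "\<star>" 70) where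
  "u \<star> v \<equiv> u \<otimes>\<^bsub>F2\<^esub> v"

abbreviation F2_inv :: "letter list \<Rightarrow> letter list" where
  "F2_inv u \<equiv> inv\<^bsub>F2\<^esub> u"

abbreviation F2_prod :: "letter list list \<Rightarrow> letter list" where
  "F2_prod us \<equiv> foldr (\<otimes>\<^bsub>F2\<^esub>) us \<one>\<^bsub>F2\<^esub>"

section \<open>Powers of a generator\<close>

lemma is_reduced_replicate: "is_reduced (replicate n x)"
  by (induction n) (auto simp: is_reduced_Cons)

lemma gen_pow_closed [simp]: "gen_pow c n \<in> carrier F2"
  by (simp add: carrier_F2 gen_pow_def is_reduced_replicate)

lemma gen_pow_0 [simp]: "gen_pow c 0 = \<one>\<^bsub>F2\<^esub>"
  by (simp add: one_F2 gen_pow_def)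

lemma push_gen_pow:
  "push (c, False) (gen_pow c n) = gen_pow c (n + 1)"
  "push (c, True) (gen_pow c n) = gen_pow c (n - 1)"
proof -
  show "push (c, False) (gen_pow c n) = gen_pow c (n + 1)"
  proof (cases "n \<ge> 0")
    case True
    then have "nat \<bar>n + 1\<bar> = Suc (nat \<bar>n\<bar>)" "n \<noteq> 0 \<Longrightarrow> nat \<bar>n\<bar> = Suc (nat \<bar>n - 1\<bar>)" by linarith+
    with True show ?thesis
      by (cases "n = 0") (auto simp: push_def gen_pow_def linv_def)
  next
    case False
    then have "nat \<bar>n\<bar> = Suc (nat \<bar>n + 1\<bar>)" by linarith
    with False show ?thesis
      by (auto simp: push_def gen_pow_def linv_def)
  qed
  show "push (c, True) (gen_pow c n) = gen_pow c (n - 1)"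
  proof (cases "n > 0")
    case True
    then have "nat \<bar>n\<bar> = Suc (nat \<bar>n - 1\<bar>)" by linarith
    with True show ?thesis
      by (auto simp: push_def gen_pow_def linv_def)
  next
    case False
    then have "nat \<bar>n - 1\<bar> = Suc (nat \<bar>n\<bar>)" "n \<noteq> 0 \<Longrightarrow> nat \<bar>n\<bar> = Suc (nat \<bar>n + 1\<bar>)" by linarith+
    with False show ?thesis
      by (cases "n = 0") (auto simp: push_def gen_pow_def linv_def)
  qed
qed

lemma funpow_push_gen_pow:
  "(push (c, e) ^^ k) (gen_pow c n) = gen_pow c (if e then n - int k else int k + n)"
  by (induction k) (auto simp: push_gen_pow algebra_simps)

lemma gen_pow_mult [simp]: "gen_pow c m \<star> gen_pow c n = gen_pow c (m + n)"
proof -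
  have "reduce (gen_pow c n) = gen_pow c n"
    using gen_pow_closed[of c n] by (simp add: carrier_F2 reduce_id)
  then show ?thesis
    by (simp add: mult_F2 reduce_append gen_pow_def[of c m] funpow_push_gen_pow add.commute)
qed

lemma gen_pow_mult_assoc [simp]:
  "u \<in> carrier F2 \<Longrightarrow> gen_pow c m \<star> gen_pow c n \<star> u = gen_pow c (m + n) \<star> u"
  by (simp flip: F2.m_assoc)

lemma inv_gen_pow [simp]: "F2_inv (gen_pow c n) = gen_pow c (- n)"
  by (rule F2.inv_equality) simp_all

section \<open>Syllables\<close>

type_synonym syllable = "bool \<times> int"

definition ev :: "syllable list \<Rightarrow> letter list" where
  "ev xs = reduce (concat (map (\<lambda>(c, n). gen_pow c n) xs))"

lemma ev_closed [simp]: "ev xs \<in> carrier F2"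
  by (simp add: ev_def carrier_F2)

lemma ev_Nil [simp]: "ev [] = \<one>\<^bsub>F2\<^esub>"
  by (simp add: ev_def one_F2)

lemma ev_append: "ev (xs @ ys) = ev xs \<star> ev ys"
  by (simp add: ev_def mult_F2)

lemma ev_Cons: "ev ((c, n) # xs) = gen_pow c n \<star> ev xs"
  by (simp add: ev_def mult_F2)

text \<open>Normal forms of the free group seen as the free product of two infinite cyclic
  groups.\<close>

definition alternating :: "syllable list \<Rightarrow> bool" where
  "alternating xs \<longleftrightarrow> (\<forall>x\<in>set xs. snd x \<noteq> 0) \<and> successively (\<lambda>x y. fst x \<noteq> fst y) xs"

lemma alternating_Nil [simp]: "alternating []"
  by (simp add: alternating_def)

lemma alternating_append:
  "alternating (xs @ ys) \<longleftrightarrow>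
     alternating xs \<and> alternating ys \<and> (xs = [] \<or> ys = [] \<or> fst (last xs) \<noteq> fst (hd ys))"
  by (auto simp: alternating_def successively_append_iff)

lemma alternating_Cons:
  "alternating (x # xs) \<longleftrightarrow> snd x \<noteq> 0 \<and> alternating xs \<and> (xs = [] \<or> fst x \<noteq> fst (hd xs))"
  by (auto simp: alternating_def successively_Cons)

lemma alternating_reduced:
  "alternating xs \<Longrightarrow> is_reduced (concat (map (\<lambda>(c, n). gen_pow c n) xs))"
proof (induction xs)
  case (Cons x xs)
  obtain c n where x: "x = (c, n)" by fastforce
  show ?case
  proof (cases xs)
    case Nil
    then show ?thesis using x by (simp add: gen_pow_def is_reduced_replicate)
  next
    case (Cons y ys)
    then obtain m where "y = (\<not> c, m)" "m \<noteq> 0" "n \<noteq> 0"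
      using Cons.prems x by (cases y) (auto simp: alternating_Cons)
    then show ?thesis
      using Cons.IH Cons.prems Cons x
      by (simp add: alternating_Cons is_reduced_append gen_pow_def is_reduced_replicate linv_def)
  qed
qed simp

text \<open>Written out letter by letter, an alternating list is already a reduced word. The
  nontriviality statements below come down to this.\<close>

lemma alternating_ev_neq_one:
  assumes "alternating xs" "xs \<noteq> []"
  shows "ev xs \<noteq> \<one>\<^bsub>F2\<^esub>"
proof -
  obtain c n ys where "xs = (c, n) # ys" using assms(2) by (cases xs) auto
  then show ?thesis
    using assms(1) alternating_reduced[OF assms(1)]
    by (auto simp: ev_def one_F2 reduce_id gen_pow_def alternating_Cons)
qed

lemma alternating_form_Cons:
  assumes "alternating xs"
  shows "\<exists>ys. alternating ys \<and> ev ys = gen_pow c n \<star> ev xs"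
proof (cases "n = 0 \<or> xs = [] \<or> fst (hd xs) \<noteq> c")
  case True
  then show ?thesis
    using assms by (cases "n = 0") (force, auto simp: alternating_Cons ev_Cons intro!: exI[of _ "(c, n) # xs"])
next
  case False
  then obtain m ys where xs: "xs = (c, m) # ys" by (cases xs) auto
  show ?thesis
  proof (cases "n + m = 0")
    case True
    then show ?thesis using assms xs by (auto simp: ev_Cons alternating_Cons)
  next
    case False
    then show ?thesis
      using assms xs by (intro exI[of _ "(c, n + m) # ys"]) (auto simp: ev_Cons alternating_Cons)
  qed
qed

lemma alternating_form:
  assumes "w \<in> carrier F2"
  obtains xs where "alternating xs" "w = ev xs"
proof -
  have "\<exists>xs. alternating xs \<and> reduce w = ev xs" for w
  proof (induction w)
    case (Cons x w)
    then obtain xs where xs: "alternating xs" "reduce w = ev xs" by blast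
    have "reduce (x # w) = reduce ([x] @ reduce w)"
      by (subst reduce_append_reduce) simp
    also have "\<dots> = gen_pow (fst x) (if snd x then - 1 else 1) \<star> ev xs"
      using xs by (cases x; cases "snd x") (simp_all add: mult_F2 gen_pow_def)
    finally show ?case using alternating_form_Cons[OF xs(1)] by metis
  qed (auto simp: one_F2 intro!: exI[of _ "[]"])
  with assms that show thesis by (metis carrier_F2 reduce_id)
qed

section \<open>Elements with prescribed first and last letters\<close>

definition words_from_to :: "bool \<Rightarrow> bool \<Rightarrow> letter list set" where
  "words_from_to c d = {ev xs |xs. alternating xs \<and> xs \<noteq> [] \<and> fst (hd xs) = c \<and> fst (last xs) = d}"

lemma words_from_toI:
  "\<lbrakk>alternating xs; xs \<noteq> []; fst (hd xs) = c; fst (last xs) = d; u = ev xs\<rbrakk> \<Longrightarrow> u \<in> words_from_to c d"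
  by (auto simp: words_from_to_def)

lemma words_from_toE:
  assumes "u \<in> words_from_to c d"
  obtains xs where "alternating xs" "xs \<noteq> []" "fst (hd xs) = c" "fst (last xs) = d" "u = ev xs"
  using assms by (auto simp: words_from_to_def)

lemma words_from_to_closed: "u \<in> words_from_to c d \<Longrightarrow> u \<in> carrier F2"
  by (auto simp: words_from_to_def)

lemma words_from_to_mult:
  assumes "u \<in> words_from_to c d" "v \<in> words_from_to d' e" "d \<noteq> d'"
  shows "u \<star> v \<in> words_from_to c e"
proof -
  obtain xs ys where
    "alternating xs" "xs \<noteq> []" "fst (hd xs) = c" "fst (last xs) = d" "u = ev xs"
    "alternating ys" "ys \<noteq> []" "fst (hd ys) = d'" "fst (last ys) = e" "v = ev ys"
    using assms by (auto elim!: words_from_toE)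
  then show ?thesis
    using assms(3) by (intro words_from_toI[of "xs @ ys"]) (auto simp: alternating_append ev_append)
qed

lemma words_from_to_neq_one: "u \<in> words_from_to c d \<Longrightarrow> u \<noteq> \<one>\<^bsub>F2\<^esub>"
  by (auto elim!: words_from_toE dest: alternating_ev_neq_one)

lemma gen_pow_in_words: "n \<noteq> 0 \<Longrightarrow> gen_pow c n \<in> words_from_to c c"
  by (rule words_from_toI[of "[(c, n)]"]) (auto simp: alternating_Cons ev_Cons)

text \<open>Conjugation gathers both outer powers in front of \<open>v\<close>; there they either
  cancel, leaving \<open>v\<close>, or form one further syllable before it.\<close>

lemma gen_pow_words_neq_one:
  assumes v: "v \<in> words_from_to (\<not> c) d"
  shows "gen_pow c m \<star> v \<star> gen_pow c n \<noteq> \<one>\<^bsub>F2\<^esub>"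
proof
  have [simp]: "v \<in> carrier F2" using v by (rule words_from_to_closed)
  assume "gen_pow c m \<star> v \<star> gen_pow c n = \<one>\<^bsub>F2\<^esub>"
  then have "gen_pow c n \<star> (gen_pow c m \<star> v \<star> gen_pow c n) \<star> gen_pow c (- n) = \<one>\<^bsub>F2\<^esub>"
    by simp
  then have "gen_pow c (n + m) \<star> v = \<one>\<^bsub>F2\<^esub>"
    by (simp add: F2.m_assoc)
  then show False
    using words_from_to_neq_one[OF words_from_to_mult[OF gen_pow_in_words v, of "n + m" c]]
      words_from_to_neq_one[OF v] by (cases "n + m = 0") auto
qed

lemma conj_pow:
  assumes [simp]: "a \<in> carrier F2" "v \<in> carrier F2"
  shows "(a \<star> v \<star> F2_inv a) [^]\<^bsub>F2\<^esub> (r::nat) = a \<star> (v [^]\<^bsub>F2\<^esub> r) \<star> F2_inv a"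
proof (induction r)
  case (Suc r)
  have "F2_inv a \<star> a \<star> u = u" if "u \<in> carrier F2" for u
    using that by (simp flip: F2.m_assoc)
  with Suc show ?case by (simp add: F2.m_assoc)
qed simp

text \<open>Induction on the number of syllables, by cyclic reduction. If the two outer syllables
  cancel, \<open>w\<close> is a conjugate of a shorter element that begins and ends with the other
  letter, and conjugation puts them back around its power. Otherwise consecutive copies merge in one
  nonzero syllable.\<close>

lemma words_from_to_pow:
  "w \<in> words_from_to c c \<Longrightarrow> w [^]\<^bsub>F2\<^esub> Suc r \<in> words_from_to c c"
proof -
  have "ev xs [^]\<^bsub>F2\<^esub> Suc r \<in> words_from_to c c"
    if "alternating xs" "xs \<noteq> []" "fst (hd xs) = c" "fst (last xs) = c" for xs c
    using that
  proof (induction "length xs" arbitrary: xs c rule: less_induct)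
    case less
    obtain n xs' where xs': "xs = (c, n) # xs'"
      using less.prems by (cases xs) auto
    show ?case
    proof (cases xs' rule: rev_cases)
      case Nil
      have pow: "gen_pow c n [^]\<^bsub>F2\<^esub> k = gen_pow c (int k * n)" for k :: nat
        by (induction k) (auto simp: algebra_simps)
      have "ev xs = gen_pow c n" "n \<noteq> 0"
        using less.prems Nil xs' by (simp_all add: ev_Cons alternating_Cons)
      moreover from this have "gen_pow c (int (Suc r) * n) \<in> words_from_to c c"
        by (intro gen_pow_in_words) (simp del: of_nat_Suc)
      ultimately show ?thesis
        by (simp only: pow)
    next
      case (snoc ys s)
      then obtain n' where xs: "xs = (c, n) # ys @ [(c, n')]"
        using less.prems xs' by (cases s) auto
      have "ys \<noteq> []"
        using less.prems(1) by (auto simp: xs alternating_Cons)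
      then have ys: "ys \<noteq> []" "alternating ys" "fst (hd ys) = (\<not> c)" "fst (last ys) = (\<not> c)" "n \<noteq> 0" "n' \<noteq> 0"
        using less.prems(1) by (auto simp: xs alternating_Cons alternating_append)
      show ?thesis
      proof (cases "n + n' = 0")
        case True
        then have "n' = - n" by simp
        then have "ev xs = gen_pow c n \<star> ev ys \<star> F2_inv (gen_pow c n)"
          by (simp add: xs ev_Cons ev_append)
        then have "ev xs [^]\<^bsub>F2\<^esub> Suc r = gen_pow c n \<star> ev ys [^]\<^bsub>F2\<^esub> Suc r \<star> gen_pow c (- n)"
          using conj_pow[of "gen_pow c n" "ev ys" "Suc r"] by (simp del: F2.nat_pow_Suc)
        moreover have "ev ys [^]\<^bsub>F2\<^esub> Suc r \<in> words_from_to (\<not> c) (\<not> c)"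
          using ys by (intro less.hyps) (auto simp: xs)
        then have "ev ys [^]\<^bsub>F2\<^esub> Suc r \<star> gen_pow c (- n) \<in> words_from_to (\<not> c) c"
          using ys by (intro words_from_to_mult[OF _ gen_pow_in_words]) auto
        then have "gen_pow c n \<star> ev ys [^]\<^bsub>F2\<^esub> Suc r \<star> gen_pow c (- n) \<in> words_from_to c c"
          using ys by (intro words_from_to_mult[OF gen_pow_in_words]) auto
        ultimately show ?thesis by simp
      next
        case False
        \<comment> \<open>The last syllable is split off so that the next copy of \<open>xs\<close>
          can merge its first syllable into it.\<close>
        have "\<exists>zs. ev xs [^]\<^bsub>F2\<^esub> Suc r = ev (zs @ [(c, n')]) \<and> alternating (zs @ [(c, n')])
                \<and> zs \<noteq> [] \<and> fst (hd zs) = c" for r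
        proof (induction r)
          case 0
          show ?case
            using less.prems by (intro exI[of _ "(c, n) # ys"]) (auto simp: xs)
        next
          case (Suc r)
          then obtain zs where zs: "ev xs [^]\<^bsub>F2\<^esub> Suc r = ev (zs @ [(c, n')])"
            "alternating (zs @ [(c, n')])" "zs \<noteq> []" "fst (hd zs) = c" by blast
          then have "ev xs [^]\<^bsub>F2\<^esub> Suc (Suc r) = ev ((zs @ (c, n' + n) # ys) @ [(c, n')])"
            by (subst F2.nat_pow_Suc) (simp add: xs ev_append ev_Cons F2.m_assoc)
          then show ?case
            using zs ys False less.prems(1)
            by (intro exI[of _ "zs @ (c, n' + n) # ys"]) (auto simp: xs alternating_Cons alternating_append)
        qed
        then show ?thesis by (force intro: words_from_toI)
      qed
    qed
  qed
  then show "w \<in> words_from_to c c \<Longrightarrow> w [^]\<^bsub>F2\<^esub> Suc r \<in> words_from_to c c"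
    by (auto elim!: words_from_toE simp del: F2.nat_pow_Suc)
qed

text \<open>The semigroup generated by \<open>U\<close> avoids the identity; for \<open>U\<close>
  the coset \<open>gH\<close> this is what relative torsion-freeness of \<open>H\<close> asks of
  \<open>g\<close>.\<close>

definition positive_free :: "letter list set \<Rightarrow> bool" where
  "positive_free U \<longleftrightarrow> (\<forall>us. us \<noteq> [] \<and> set us \<subseteq> U \<longrightarrow> F2_prod us \<noteq> \<one>\<^bsub>F2\<^esub>)"

lemma positive_freeI:
  "(\<And>us. us \<noteq> [] \<Longrightarrow> set us \<subseteq> U \<Longrightarrow> F2_prod us \<noteq> \<one>\<^bsub>F2\<^esub>) \<Longrightarrow> positive_free U"
  by (auto simp: positive_free_def)

lemma F2_prod_closed [simp]: "set us \<subseteq> carrier F2 \<Longrightarrow> F2_prod us \<in> carrier F2"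
  by (induction us) auto

text \<open>Adjacent factors \<open>F2_inv p\<close> and \<open>p\<close> cancel, so a product over
  \<open>V\<close> is a conjugate of one over \<open>U\<close>. This allows the endpoints of paths
  to be moved.\<close>

lemma positive_free_conj:
  assumes U: "positive_free U" "U \<subseteq> carrier F2" and [simp]: "p \<in> carrier F2"
    and V: "\<And>v. v \<in> V \<Longrightarrow> \<exists>u\<in>U. v = p \<star> u \<star> F2_inv p"
  shows "positive_free V"
proof (rule positive_freeI)
  fix vs assume "vs \<noteq> []" "set vs \<subseteq> V"
  then have "\<exists>us. us \<noteq> [] \<and> set us \<subseteq> U \<and> F2_prod vs = p \<star> F2_prod us \<star> F2_inv p"
  proof (induction vs rule: list_nonempty_induct)
    case (single v)
    then obtain u where "u \<in> U" "v = p \<star> u \<star> F2_inv p" using V by auto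
    then show ?case using U(2) by (intro exI[of _ "[u]"]) auto
  next
    case (cons v vs)
    then obtain u where "u \<in> U" "v = p \<star> u \<star> F2_inv p" using V by auto
    moreover from cons obtain us where
      "us \<noteq> []" "set us \<subseteq> U" "F2_prod vs = p \<star> F2_prod us \<star> F2_inv p" by auto
    ultimately have u: "u \<in> U" "v = p \<star> u \<star> F2_inv p"
      "us \<noteq> []" "set us \<subseteq> U" "F2_prod vs = p \<star> F2_prod us \<star> F2_inv p" by blast+
    then have [simp]: "u \<in> carrier F2" "F2_prod us \<in> carrier F2" using U(2) by auto
    have "F2_inv p \<star> p \<star> x = x" if "x \<in> carrier F2" for x
      using that by (simp flip: F2.m_assoc)
    then show ?case using u by (intro exI[of _ "u # us"]) (auto simp: F2.m_assoc)
  qed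
  then obtain us where us: "us \<noteq> []" "set us \<subseteq> U" "F2_prod vs = p \<star> F2_prod us \<star> F2_inv p" by blast
  then have [simp]: "F2_prod us \<in> carrier F2" using U(2) by auto
  show "F2_prod vs \<noteq> \<one>\<^bsub>F2\<^esub>"
  proof
    assume "F2_prod vs = \<one>\<^bsub>F2\<^esub>"
    then have "(p \<star> F2_prod us) \<star> F2_inv p = \<one>\<^bsub>F2\<^esub>"
      using us by (simp add: F2.m_assoc)
    then have "p \<star> F2_prod us = p"
      using F2.inv_equality[of "p \<star> F2_prod us" "F2_inv p"] by simp
    then have "F2_prod us = \<one>\<^bsub>F2\<^esub>" by simp
    with us U(1) show False by (auto simp: positive_free_def)
  qed
qed

lemma positive_free_words:
  assumes "U \<subseteq> words_from_to c (\<not> c)"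
  shows "positive_free U"
proof (rule positive_freeI)
  fix us assume "us \<noteq> []" "set us \<subseteq> U"
  then have "F2_prod us \<in> words_from_to c (\<not> c)"
    using assms
  proof (induction us rule: list_nonempty_induct)
    case (single u)
    then show ?case using words_from_to_closed by fastforce
  next
    case (cons u us)
    then show ?case using words_from_to_mult[of u c "\<not> c" "F2_prod us" c] by auto
  qed
  then show "F2_prod us \<noteq> \<one>\<^bsub>F2\<^esub>" by (rule words_from_to_neq_one)
qed

text \<open>A trivial factor from \<open>U\<close> makes two copies of \<open>w\<close> meet,
  possibly with cancellation. A run of copies is a power of \<open>w\<close>, which keeps the outer
  letters of \<open>w\<close>, so it does not cancel against the nontrivial factors from
  \<open>U\<close>.\<close>

lemma positive_free_pow:
  assumes w: "w \<in> words_from_to (\<not> c) (\<not> c)"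
    and U: "U \<subseteq> insert \<one>\<^bsub>F2\<^esub> (words_from_to c c)"
  shows "positive_free ((\<star>) w ` U)"
proof (rule positive_freeI)
  fix us assume "us \<noteq> []" "set us \<subseteq> (\<star>) w ` U"
  have pow: "w [^]\<^bsub>F2\<^esub> Suc r \<in> words_from_to (\<not> c) (\<not> c)" for r
    using w by (rule words_from_to_pow)
  have [simp]: "w \<in> carrier F2" using w by (rule words_from_to_closed)
  from \<open>us \<noteq> []\<close> \<open>set us \<subseteq> (\<star>) w ` U\<close>
  \<comment> \<open>\<open>t\<close> is what follows the leading run of copies of
    \<open>w\<close>.\<close>
  have "\<exists>r t. F2_prod us = w [^]\<^bsub>F2\<^esub> Suc r \<star> t \<and> (t = \<one>\<^bsub>F2\<^esub> \<or> (\<exists>e. t \<in> words_from_to c e))"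
  proof (induction us rule: list_nonempty_induct)
    case (single v)
    then obtain u where u: "u \<in> U" "v = w \<star> u" by auto
    then have "u = \<one>\<^bsub>F2\<^esub> \<or> u \<in> words_from_to c c" using U by auto
    then show ?case
      using u words_from_to_closed[of u c c] by (intro exI[of _ 0] exI[of _ u]) auto
  next
    case (cons v us)
    then obtain u r t where u: "u \<in> U" "v = w \<star> u" and
      t: "F2_prod us = w [^]\<^bsub>F2\<^esub> Suc r \<star> t" "t = \<one>\<^bsub>F2\<^esub> \<or> (\<exists>e. t \<in> words_from_to c e)" by auto
    have [simp]: "t \<in> carrier F2" using t(2) words_from_to_closed by auto
    consider "u = \<one>\<^bsub>F2\<^esub>" | "u \<in> words_from_to c c" using U u by auto
    then show ?case
    proof cases
      case 1
      then have "F2_prod (v # us) = (w \<star> w [^]\<^bsub>F2\<^esub> Suc r) \<star> t"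
        using u t by (simp add: F2.m_assoc del: F2.nat_pow_Suc)
      also have "w \<star> w [^]\<^bsub>F2\<^esub> Suc r = w [^]\<^bsub>F2\<^esub> Suc (Suc r)"
        by (simp only: F2.nat_pow_Suc2[of w "Suc r"] \<open>w \<in> carrier F2\<close>)
      finally have "F2_prod (v # us) = w [^]\<^bsub>F2\<^esub> Suc (Suc r) \<star> t" .
      then show ?thesis using t(2) by blast
    next
      case 2
      have "w [^]\<^bsub>F2\<^esub> Suc r \<star> t \<in> words_from_to (\<not> c) (\<not> c) \<or> (\<exists>e. w [^]\<^bsub>F2\<^esub> Suc r \<star> t \<in> words_from_to (\<not> c) e)"
        using t(2)
      proof (elim disjE exE)
        fix e assume "t \<in> words_from_to c e"
        then show ?thesis using words_from_to_mult[OF pow[of r], of t c e] by blast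
      qed (use pow[of r] in \<open>simp del: F2.nat_pow_Suc\<close>)
      then have "\<exists>e. u \<star> w [^]\<^bsub>F2\<^esub> Suc r \<star> t \<in> words_from_to c e"
        using words_from_to_mult[OF 2] by blast
      moreover have "F2_prod (v # us) = w [^]\<^bsub>F2\<^esub> Suc 0 \<star> u \<star> w [^]\<^bsub>F2\<^esub> Suc r \<star> t"
        using u t words_from_to_closed[OF 2] by (simp add: F2.m_assoc)
      ultimately show ?thesis by blast
    qed
  qed
  then obtain r t where "F2_prod us = w [^]\<^bsub>F2\<^esub> Suc r \<star> t"
    "t = \<one>\<^bsub>F2\<^esub> \<or> (\<exists>e. t \<in> words_from_to c e)" by blast
  then show "F2_prod us \<noteq> \<one>\<^bsub>F2\<^esub>"
    using words_from_to_neq_one[OF words_from_to_mult[OF pow]] words_from_to_neq_one[OF pow]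
    by (auto simp del: F2.nat_pow_Suc)
qed

section \<open>Lines glued at junctions\<close>

text \<open>A vertex is a triple \<open>(c, l, x)\<close>: position \<open>x\<close> on the line \<open>l\<close> along which the generator \<open>c\<close>
acts by translation. A junction \<open>J\<close> has two such names, one for each \<open>c\<close>, and the rule
\<open>conn_switch\<close> identifies them; all other vertices have only one name.\<close>

locale junction_graph =
  fixes Js :: "'j set" and lin :: "bool \<Rightarrow> 'j \<Rightarrow> 'l" and crd :: "bool \<Rightarrow> 'j \<Rightarrow> int"
  assumes segment_unique:
    "\<lbrakk>J \<in> Js; J' \<in> Js; K \<in> Js; K' \<in> Js; J \<noteq> J'; lin c J = lin c J'; lin c K = lin c K';
      crd c J' - crd c J = crd c K' - crd c K\<rbrakk> \<Longrightarrow> J = K"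
  and lines_meet_once: "\<lbrakk>J \<in> Js; K \<in> Js; lin c J = lin c K; lin (\<not> c) J = lin (\<not> c) K\<rbrakk> \<Longrightarrow> J = K"
begin

text \<open>In \<open>segment_unique\<close> the junctions \<open>K\<close> and \<open>K'\<close>
  may coincide, so a displacement between distinct junctions can be compared with zero.\<close>

lemma crd_inj: "\<lbrakk>J \<in> Js; K \<in> Js; lin c J = lin c K; crd c J = crd c K\<rbrakk> \<Longrightarrow> J = K"
  using segment_unique[of J K K K c] by auto

text \<open>Labels are group elements rather than words, so backtracking is built in; a path with
  trivial label joins two names of one vertex.\<close>

inductive conn :: "bool \<times> 'l \<times> int \<Rightarrow> letter list \<Rightarrow> bool \<times> 'l \<times> int \<Rightarrow> bool" where
  conn_refl: "conn P \<one>\<^bsub>F2\<^esub> P"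
| conn_move: "conn (c, l, x + n) u P \<Longrightarrow> conn (c, l, x) (gen_pow c n \<star> u) P"
| conn_switch: "J \<in> Js \<Longrightarrow> conn (\<not> c, lin (\<not> c) J, crd (\<not> c) J) u P \<Longrightarrow> conn (c, lin c J, crd c J) u P"

lemma conn_closed: "conn P u Q \<Longrightarrow> u \<in> carrier F2"
  by (induction rule: conn.induct) auto

lemma conn_trans: "conn P u Q \<Longrightarrow> conn Q v R \<Longrightarrow> conn P (u \<star> v) R"
proof (induction rule: conn.induct)
  case (conn_move c l x n u P)
  then show ?case
    using conn.conn_move[of c l x n "u \<star> v" R] by (simp add: F2.m_assoc conn_closed)
qed (auto simp: conn_closed intro: conn.intros)

lemma conn_gen_pow: "conn (c, l, x) (gen_pow c n) (c, l, x + n)"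
  using conn_move[OF conn_refl, of c l x n] by simp

lemma conn_inv: "conn P u Q \<Longrightarrow> conn Q (F2_inv u) P"
proof (induction rule: conn.induct)
  case (conn_refl P)
  then show ?case using conn.conn_refl by simp
next
  case (conn_move c l x n u P)
  then show ?case
    using conn_trans[OF conn_move.IH conn_gen_pow[of c l "x + n" "- n"]] conn_closed
    by (simp add: F2.inv_mult_group)
next
  case (conn_switch J c u P)
  then show ?case
    using conn_trans[OF conn_switch.IH conn.conn_switch[OF conn_switch.hyps(1), of "\<not> c" "\<one>\<^bsub>F2\<^esub>"]]
      conn_refl conn_closed by simp
qed

lemma conn_switch_iff:
  "J \<in> Js \<Longrightarrow> conn (\<not> c, lin (\<not> c) J, crd (\<not> c) J) u P \<longleftrightarrow> conn (c, lin c J, crd c J) u P"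
  using conn_switch[of J c u P] conn_switch[of J "\<not> c" u P] by auto

lemma conn_switch_iff_right:
  assumes "J \<in> Js"
  shows "conn P u (\<not> c, lin (\<not> c) J, crd (\<not> c) J) \<longleftrightarrow> conn P u (c, lin c J, crd c J)"
  by (metis assms conn_closed conn_inv conn_switch_iff F2.inv_inv)

text \<open>Each segment runs between distinct junctions and the letter changes at every stop, so
  \<open>xs\<close> is the normal form of the label.\<close>

inductive jpath :: "'j \<Rightarrow> syllable list \<Rightarrow> 'j \<Rightarrow> bool" where
  jpath_Nil: "J \<in> Js \<Longrightarrow> jpath J [] J"
| jpath_Cons: "\<lbrakk>jpath J' xs K; J \<in> Js; J \<noteq> J'; lin c J = lin c J'; xs = [] \<or> fst (hd xs) = (\<not> c)\<rbrakk>
    \<Longrightarrow> jpath J ((c, crd c J' - crd c J) # xs) K"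

lemma jpath_in: assumes "jpath J xs K" shows "J \<in> Js" "K \<in> Js"
  using assms by (induction rule: jpath.induct) auto

lemma jpath_alternating: "jpath J xs K \<Longrightarrow> alternating xs"
proof (induction rule: jpath.induct)
  case (jpath_Cons J' xs K J c)
  then show ?case
    using crd_inj[of J J' c] jpath_in(1)[of J' xs K] by (auto simp: alternating_Cons)
qed simp

definition leaves :: "'j \<Rightarrow> syllable \<Rightarrow> bool" where
  "leaves J s \<longleftrightarrow> J \<in> Js \<and> (\<exists>J'\<in>Js. J \<noteq> J' \<and> lin (fst s) J = lin (fst s) J' \<and> snd s = crd (fst s) J' - crd (fst s) J)"

definition arrives :: "'j \<Rightarrow> syllable \<Rightarrow> bool" where
  "arrives K s \<longleftrightarrow> K \<in> Js \<and> (\<exists>K'\<in>Js. K' \<noteq> K \<and> lin (fst s) K' = lin (fst s) K \<and> snd s = crd (fst s) K - crd (fst s) K')"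

text \<open>Reversed, the arriving segment starts at \<open>K\<close>. If the two cancelled, it
  would have the displacement of the segment leaving \<open>J\<close>, and
  \<open>segment_unique\<close> would give \<open>J = K\<close>.\<close>

lemma arrives_leaves_no_cancel:
  assumes "arrives K s" "leaves J t" "fst s = fst t" "K \<noteq> J"
  shows "snd s + snd t \<noteq> 0"
proof
  assume sum: "snd s + snd t = 0"
  obtain K' where "K \<in> Js" "K' \<in> Js" "K' \<noteq> K" "lin (fst t) K' = lin (fst t) K"
    "snd s = crd (fst t) K - crd (fst t) K'"
    using assms(1,3) unfolding arrives_def by auto
  moreover obtain J' where "J \<in> Js" "J' \<in> Js" "J \<noteq> J'" "lin (fst t) J = lin (fst t) J'"
    "snd t = crd (fst t) J' - crd (fst t) J"
    using assms(2) unfolding leaves_def by auto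
  ultimately show False
    using sum assms(4) segment_unique[of J J' K K' "fst t"] by auto
qed

lemma jpath_leaves: "jpath J xs K \<Longrightarrow> xs \<noteq> [] \<Longrightarrow> leaves J (hd xs)"
  by (erule jpath.cases) (auto simp: leaves_def dest: jpath_in)

lemma jpath_arrives: "jpath J xs K \<Longrightarrow> xs \<noteq> [] \<Longrightarrow> arrives K (last xs)"
proof (induction rule: jpath.induct)
  case (jpath_Cons J' xs K J c)
  then show ?case
    by (cases "xs = []") (auto simp: arrives_def elim: jpath.cases dest: jpath_in)
qed simp

lemma jpath_append:
  "\<lbrakk>jpath J xs K; jpath K ys L; xs = [] \<or> ys = [] \<or> fst (hd ys) \<noteq> fst (last xs)\<rbrakk> \<Longrightarrow> jpath J (xs @ ys) L"
proof (induction rule: jpath.induct)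
  case (jpath_Cons J' xs K J c)
  then show ?case
    by (cases "xs = []") (auto intro!: jpath.jpath_Cons)
qed simp

text \<open>The shape of a path without backtracking: it stays on one line, or it goes along
  \<open>c\<close> to a junction \<open>J\<close>, over full segments to \<open>K\<close>, then
  along \<open>d\<close>. The outer powers vanish when it already starts at \<open>J\<close> or ends
  at \<open>K\<close>.\<close>

inductive normal :: "bool \<times> 'l \<times> int \<Rightarrow> letter list \<Rightarrow> bool \<times> 'l \<times> int \<Rightarrow> bool" where
  normal_direct: "u = gen_pow c (y - x) \<Longrightarrow> normal (c, l, x) u (c, l, y)"
| normal_via: "\<lbrakk>jpath J xs K; xs = [] \<Longrightarrow> d = (\<not> c); xs \<noteq> [] \<Longrightarrow> fst (hd xs) = (\<not> c) \<and> fst (last xs) = (\<not> d);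
    lin c J = l; lin d K = l'; u = gen_pow c (crd c J - x) \<star> ev xs \<star> gen_pow d (y - crd d K)\<rbrakk>
    \<Longrightarrow> normal (c, l, x) u (d, l', y)"

lemma conn_normal: "conn P u Q \<Longrightarrow> normal P u Q"
proof (induction rule: conn.induct)
  case (conn_refl P)
  then show ?case by (cases P) (auto intro: normal_direct)
next
  case (conn_move c l x n u P)
  from conn_move.IH show ?case
  proof cases
    case normal_direct
    then show ?thesis by (auto intro!: normal.normal_direct)
  next
    case (normal_via J xs K d l' y)
    then show ?thesis by (auto intro!: normal.normal_via[of J xs K d c])
  qed
next
  case (conn_switch J0 c u P)
  from conn_switch.IH show ?case
  proof cases
    case (normal_direct y)
    then show ?thesis
      using jpath_Nil[of J0] conn_switch.hyps(1)
      by (auto intro!: normal.normal_via[of J0 "[]" J0 "\<not> c" c])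
  next
    case (normal_via J xs K d l' y)
    \<comment> \<open>If \<open>J\<close> differs from \<open>J0\<close>, the move between them
      becomes a new first syllable of the junction path. If not, that move is trivial, and the first
      syllable of \<open>xs\<close>, if there is one, becomes the outer power.\<close>
    show ?thesis
    proof (cases "J = J0")
      case False
      define s where "s = (\<not> c, crd (\<not> c) J - crd (\<not> c) J0)"
      have "jpath J0 (s # xs) K"
        unfolding s_def using normal_via False conn_switch.hyps(1) by (intro jpath_Cons) auto
      then show ?thesis
        unfolding \<open>P = _\<close>
        by (rule normal.normal_via)
           (use normal_via in \<open>auto simp: s_def ev_Cons F2.m_assoc\<close>)
    next
      case True
      show ?thesis
      proof (cases xs)
        case Nil
        with normal_via True have "J0 = K" "d = c" by (auto elim: jpath.cases)
        with normal_via True Nil show ?thesis by (auto intro!: normal.normal_direct)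
      next
        case (Cons s ys)
        with normal_via(2) have "jpath J (s # ys) K" by simp
        then obtain J' where J': "jpath J' ys K" "lin (fst s) J = lin (fst s) J'"
          "s = (fst s, crd (fst s) J' - crd (fst s) J)" "ys = [] \<or> fst (hd ys) = (\<not> fst s)"
          by cases auto
        moreover have s: "fst s = c" using normal_via Cons by auto
        ultimately have u: "u = gen_pow c (crd c J' - crd c J0) \<star> ev ys \<star> gen_pow d (y - crd d K)"
          using normal_via True Cons ev_Cons[of c "crd c J' - crd c J0" ys] by (simp add: F2.m_assoc)
        show ?thesis
          unfolding \<open>P = _\<close>
          by (rule normal.normal_via[OF J'(1) _ _ _ _ u])
             (use normal_via Cons s J' True in \<open>auto split: if_splits\<close>)
      qed
    qed
  qed
qed

text \<open>Away from junctions both outer powers of the normal form are nonzero, so nothing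
  merges.\<close>

lemma conn_nonjunction_ends:
  assumes "conn (c, l, x) u (d, l', y)"
    and nonjunction: "\<And>J. J \<in> Js \<Longrightarrow> (lin c J, crd c J) \<noteq> (l, x)" "\<And>J. J \<in> Js \<Longrightarrow> (lin d J, crd d J) \<noteq> (l', y)"
  shows "u \<in> words_from_to c d \<or> (u = \<one>\<^bsub>F2\<^esub> \<and> (c, l, x) = (d, l', y))"
  using conn_normal[OF assms(1)]
proof cases
  case normal_direct
  then show ?thesis using gen_pow_in_words[of "y - x" c] by (cases "x = y") auto
next
  case (normal_via J xs K)
  have "u = ev ((c, crd c J - x) # xs @ [(d, y - crd d K)])"
    using normal_via by (simp add: ev_append ev_Cons)
  moreover have "alternating ((c, crd c J - x) # xs @ [(d, y - crd d K)])"
    using normal_via nonjunction[of J] nonjunction[of K] jpath_in[OF normal_via(1)] jpath_alternating[OF normal_via(1)]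
    by (cases "xs = []") (auto simp: alternating_Cons alternating_append)
  ultimately show ?thesis by (auto intro: words_from_toI)
qed

lemma positive_free_different_letters:
  assumes "\<And>J. J \<in> Js \<Longrightarrow> (lin c J, crd c J) \<noteq> (l, x)" "\<And>J. J \<in> Js \<Longrightarrow> (lin (\<not> c) J, crd (\<not> c) J) \<noteq> (l', y)"
  shows "positive_free {u. conn (c, l, x) u (\<not> c, l', y)}"
  by (rule positive_free_words[of _ c]) (use conn_nonjunction_ends[OF _ assms] in auto)

text \<open>The letters of \<open>w\<close> and of a nontrivial path differ wherever the two adjoin,
  so nothing cancels there. A path label can be trivial only if the two vertices coincide, and then
  \<open>positive_free_pow\<close> applies.\<close>

lemma positive_free_outside:
  assumes w: "w \<in> words_from_to (\<not> d) (\<not> c)"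
    and "\<And>J. J \<in> Js \<Longrightarrow> (lin c J, crd c J) \<noteq> (l, x)" "\<And>J. J \<in> Js \<Longrightarrow> (lin d J, crd d J) \<noteq> (l', y)"
  shows "positive_free ((\<star>) w ` {u. conn (c, l, x) u (d, l', y)})"
proof (cases "(c, l, x) = (d, l', y)")
  case True
  then show ?thesis
    using w conn_nonjunction_ends[OF _ assms(2,3)] by (intro positive_free_pow[of w c]) auto
next
  case False
  then have "u \<in> words_from_to c d" if "conn (c, l, x) u (d, l', y)" for u
    using conn_nonjunction_ends[OF that assms(2,3)] by auto
  then show ?thesis
    using words_from_to_mult[OF w, of _ c d] by (intro positive_free_words[of _ "\<not> d"]) auto
qed

section \<open>Products of paths between two vertices\<close>

text \<open>Each path leaves \<open>l\<close> at some \<open>J\<close> and enters \<open>l'\<close>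
  at some \<open>K\<close>. Where two paths meet, the exponent left on \<open>c\<close> is the
  difference of the offsets compared in \<open>no_common\<close>, so it is nonzero.\<close>

lemma positive_free_disjoint_lines:
  assumes "l \<noteq> l'"
    and no_common: "\<And>J K. \<lbrakk>J \<in> Js; K \<in> Js; lin c J = l; lin c K = l'\<rbrakk> \<Longrightarrow> crd c J - x \<noteq> crd c K - y"
  shows "positive_free {u. conn (c, l, x) u (c, l', y)}"
proof (rule positive_freeI)
  fix us assume "us \<noteq> []" "set us \<subseteq> {u. conn (c, l, x) u (c, l', y)}"
  have form: "\<exists>J K v. J \<in> Js \<and> K \<in> Js \<and> lin c J = l \<and> lin c K = l' \<and> v \<in> words_from_to (\<not> c) (\<not> c)
      \<and> u = gen_pow c (crd c J - x) \<star> v \<star> gen_pow c (y - crd c K)" if "conn (c, l, x) u (c, l', y)" for u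
    using conn_normal[OF that]
  proof cases
    case (normal_via J xs K)
    then have "ev xs \<in> words_from_to (\<not> c) (\<not> c)"
      using jpath_alternating by (intro words_from_toI[of xs]) auto
    with normal_via show ?thesis using jpath_in by blast
  qed (use assms in auto)
  from \<open>us \<noteq> []\<close> \<open>set us \<subseteq> _\<close>
  have "\<exists>J K v. J \<in> Js \<and> K \<in> Js \<and> lin c J = l \<and> lin c K = l' \<and> v \<in> words_from_to (\<not> c) (\<not> c)
      \<and> F2_prod us = gen_pow c (crd c J - x) \<star> v \<star> gen_pow c (y - crd c K)"
  proof (induction us rule: list_nonempty_induct)
    case (single u)
    then show ?case using form[of u] conn_closed[of _ u] by auto
  next
    case (cons u us)
    then obtain J' K' v' where v': "J' \<in> Js" "K' \<in> Js" "lin c J' = l" "lin c K' = l'"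
      "v' \<in> words_from_to (\<not> c) (\<not> c)" "F2_prod us = gen_pow c (crd c J' - x) \<star> v' \<star> gen_pow c (y - crd c K')"
      by auto
    have "conn (c, l, x) u (c, l', y)" using cons.prems by auto
    from form[OF this] obtain J K v where v: "J \<in> Js" "K \<in> Js" "lin c J = l" "lin c K = l'"
      "v \<in> words_from_to (\<not> c) (\<not> c)" "u = gen_pow c (crd c J - x) \<star> v \<star> gen_pow c (y - crd c K)"
      by blast
    have [simp]: "v \<in> carrier F2" "v' \<in> carrier F2"
      using v(5) v'(5) by (auto intro: words_from_to_closed)
    define n where "n = y - crd c K + (crd c J' - x)"
    have "F2_prod (u # us) = gen_pow c (crd c J - x) \<star> (v \<star> gen_pow c n \<star> v') \<star> gen_pow c (y - crd c K')"
      using v v' by (simp add: F2.m_assoc n_def)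
    moreover have "n \<noteq> 0"
      using no_common[of J' K] v v' by (auto simp: n_def)
    then have "v \<star> gen_pow c n \<star> v' \<in> words_from_to (\<not> c) (\<not> c)"
      using words_from_to_mult[OF gen_pow_in_words v'(5)] by (intro words_from_to_mult[OF v(5)]) auto
    ultimately show ?case using v v' by blast
  qed
  then show "F2_prod us \<noteq> \<one>\<^bsub>F2\<^esub>" using gen_pow_words_neq_one by metis
qed

text \<open>A path between junctions without a common line has at least two syllables, so its two
  ends are affected independently. Where two paths meet, the segment into \<open>K\<close> and the
  segment out of \<open>J\<close> may merge but cannot cancel.\<close>

lemma positive_free_junctions:
  assumes JK: "J \<in> Js" "K \<in> Js" and lines: "\<And>c. lin c J \<noteq> lin c K"
  shows "positive_free {u. conn (c, lin c J, crd c J) u (c, lin c K, crd c K)}"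
proof (rule positive_freeI)
  fix us assume "us \<noteq> []" "set us \<subseteq> {u. conn (c, lin c J, crd c J) u (c, lin c K, crd c K)}"
  have form: "\<exists>xs. u = ev xs \<and> jpath J xs K" if "conn (c, lin c J, crd c J) u (c, lin c K, crd c K)" for u
    using conn_normal[OF that]
  proof cases
    case (normal_via J' xs K')
    \<comment> \<open>Here the outer powers run between junctions, so unless trivial they are
      segments themselves; \<open>zs\<close> and \<open>ys\<close> attach them to the junction
      path.\<close>
    define ys where "ys = (if K' = K then [] else [(c, crd c K - crd c K')])"
    define zs where "zs = (if J = J' then [] else [(c, crd c J' - crd c J)])"
    have in_Js: "J' \<in> Js" "K' \<in> Js" using jpath_in[OF normal_via(1)] by auto
    have "jpath K' ys K"
      unfolding ys_def using JK normal_via in_Js jpath_Cons[OF jpath_Nil[of K], of K' c] by (auto intro: jpath_Nil)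
    moreover have "jpath J zs J'"
      unfolding zs_def using JK normal_via in_Js jpath_Cons[OF jpath_Nil[of J'], of J c] by (auto intro: jpath_Nil)
    moreover have "xs \<noteq> []" using normal_via by auto
    ultimately have "jpath J (zs @ xs @ ys) K"
      using normal_via by (intro jpath_append[of J zs J'] jpath_append[of J' xs K']) (auto simp: ys_def zs_def)
    moreover have "u = ev (zs @ xs @ ys)"
      using normal_via by (auto simp: ev_append ys_def zs_def ev_Cons)
    ultimately show ?thesis by blast
  qed (use lines[of c] in auto)
  have long: "\<exists>ys t. xs = ys @ [t] \<and> ys \<noteq> [] \<and> arrives K t \<and> leaves J (hd ys) \<and> alternating xs"
    if path: "jpath J xs K" for xs
  proof -
    have "xs \<noteq> []" using path lines by (auto elim: jpath.cases)
    moreover have "butlast xs \<noteq> []"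
    proof
      assume "butlast xs = []"
      with \<open>xs \<noteq> []\<close> obtain s where "xs = [s]" by (cases xs) (auto split: if_splits)
      with path show False using lines by (auto elim!: jpath.cases)
    qed
    moreover have "hd (butlast xs) = hd xs"
      using \<open>xs \<noteq> []\<close> \<open>butlast xs \<noteq> []\<close> by (cases xs) (auto split: if_splits)
    ultimately show ?thesis
      using jpath_leaves[OF path] jpath_arrives[OF path] jpath_alternating[OF path]
      by (intro exI[of _ "butlast xs"] exI[of _ "last xs"]) auto
  qed
  from \<open>us \<noteq> []\<close> \<open>set us \<subseteq> _\<close>
  \<comment> \<open>The first syllable stays a full segment out of \<open>J\<close>, ready to meet
    the next factor on its left.\<close>
  have "\<exists>s xs. F2_prod us = ev (s # xs) \<and> alternating (s # xs) \<and> xs \<noteq> [] \<and> leaves J s"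
  proof (induction us rule: list_nonempty_induct)
    case (single u)
    then obtain xs ys t where "u = ev xs" "xs = ys @ [t]" "ys \<noteq> []" "leaves J (hd ys)" "alternating xs"
      using form long by (metis insert_subset list.simps(15) mem_Collect_eq)
    then show ?case by (cases ys) auto
  next
    case (cons u us)
    then obtain s zs where s: "F2_prod us = ev (s # zs)" "alternating (s # zs)" "zs \<noteq> []" "leaves J s"
      by auto
    obtain xs ys t where t: "u = ev xs" "xs = ys @ [t]" "ys \<noteq> []" "arrives K t" "leaves J (hd ys)" "alternating xs"
      using form long cons.prems by (metis insert_subset list.simps(15) mem_Collect_eq)
    obtain r rs where ys: "ys = r # rs" using t(3) by (cases ys) auto
    show ?case
    proof (cases "fst t = fst s")
      case False
      then show ?thesis
        using s t ys by (intro exI[of _ r] exI[of _ "rs @ t # s # zs"])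
          (auto simp: alternating_Cons alternating_append hd_append simp flip: ev_append)
    next
      case True
      have "snd t + snd s \<noteq> 0"
        using arrives_leaves_no_cancel[OF t(4) s(4) True] lines[of c] by auto
      moreover have "F2_prod (u # us) = ev (r # rs @ (fst t, snd t + snd s) # zs)"
        using s t ys True by (cases s; cases t; cases r) (auto simp: ev_append ev_Cons F2.m_assoc)
      ultimately show ?thesis
        using s t ys True by (intro exI[of _ r] exI[of _ "rs @ (fst t, snd t + snd s) # zs"])
          (auto simp: alternating_Cons alternating_append hd_append)
    qed
  qed
  then show "F2_prod us \<noteq> \<one>\<^bsub>F2\<^esub>" using alternating_ev_neq_one by fastforce
qed

lemma positive_free_same_line:
  assumes "x \<noteq> y"
  shows "positive_free {u. conn (c, l, x) u (c, l, y)}"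
proof (rule positive_freeI)
  fix us assume "us \<noteq> []" "set us \<subseteq> {u. conn (c, l, x) u (c, l, y)}"
  \<comment> \<open>\<open>gen_pow c i\<close> is the only path not leaving \<open>l\<close>; powers of it can bridge the junctions \<open>K\<close> and
    \<open>J'\<close> at which two longer paths arrive and depart, but only if \<open>K - J'\<close> is a nonzero multiple of \<open>i\<close>.\<close>
  define i where "i = y - x"
  have i: "i \<noteq> 0" using assms by (simp add: i_def)
  have form: "u = gen_pow c i \<or> (\<exists>J K s xs t. J \<in> Js \<and> K \<in> Js \<and> lin c J = l \<and> lin c K = l \<and>
      alternating (s # xs @ [t]) \<and> xs \<noteq> [] \<and> leaves J s \<and> arrives K t \<and> fst s = (\<not> c) \<and> fst t = (\<not> c)
      \<and> u = gen_pow c (crd c J - x) \<star> ev (s # xs @ [t]) \<star> gen_pow c (y - crd c K))"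
    if "conn (c, l, x) u (c, l, y)" for u
    using conn_normal[OF that]
  proof cases
    case (normal_via J zs K)
    then have "zs \<noteq> []" by auto
    then obtain s zs' where zs: "zs = s # zs'" by (cases zs) auto
    \<comment> \<open>A single syllable would join two junctions of \<open>l\<close> along a line of
      the other letter, and these lines meet only once.\<close>
    have "zs' \<noteq> []"
    proof
      assume "zs' = []"
      then have "J \<in> Js" "K \<in> Js" "J \<noteq> K" "lin (\<not> c) J = lin (\<not> c) K"
        using normal_via zs by (auto elim!: jpath.cases)
      then show False using lines_meet_once[of J K c] normal_via by auto
    qed
    then obtain xs t where zs': "zs' = xs @ [t]" by (cases zs' rule: rev_cases) auto
    have alt: "alternating (s # xs @ [t])" using jpath_alternating normal_via zs zs' by blast
    have st: "fst s = (\<not> c)" "fst t = (\<not> c)" using normal_via zs zs' by auto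
    with alt have "xs \<noteq> []" by (auto simp: alternating_Cons)
    moreover have "leaves J s" "arrives K t"
      using jpath_leaves[OF normal_via(1)] jpath_arrives[OF normal_via(1)] by (auto simp: zs zs')
    ultimately show ?thesis
      using normal_via jpath_in[OF normal_via(1)] alt st zs zs' by blast
  qed (simp add: i_def)
  from \<open>us \<noteq> []\<close> \<open>set us \<subseteq> _\<close>
  \<comment> \<open>In \<open>?long\<close>, \<open>r\<close> counts the factors
    \<open>gen_pow c i\<close> before the first long one, and \<open>J\<close> is the junction where
    that one leaves \<open>l\<close>.\<close>
  have "(\<exists>r. F2_prod us = gen_pow c ((int r + 1) * i)) \<or>
    (\<exists>r J s xs. lin c J = l \<and> F2_prod us = gen_pow c (int r * i + crd c J - x) \<star> ev (s # xs) \<and>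
       alternating (s # xs) \<and> xs \<noteq> [] \<and> leaves J s \<and> fst s = (\<not> c))"
    (is "?short us \<or> ?long us")
  proof (induction us)
    case (Cons u us)
    then have "conn (c, l, x) u (c, l, y)" by auto
    then have [simp]: "u \<in> carrier F2" by (rule conn_closed)
    have IH: "(\<exists>r. F2_prod us = gen_pow c (int r * i)) \<or> ?long us"
    proof (cases "us = []")
      case True
      then show ?thesis by (auto intro!: exI[of _ 0])
    next
      case False
      with Cons have "?short us \<or> ?long us" by auto
      then show ?thesis by (metis of_nat_Suc add.commute)
    qed
    from form[OF \<open>conn (c, l, x) u (c, l, y)\<close>] show ?case
    proof (elim disjE exE conjE)
      assume u: "u = gen_pow c i"
      from IH show ?thesis
      proof (elim disjE exE conjE)
        fix r assume "F2_prod us = gen_pow c (int r * i)"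
        then have "F2_prod (u # us) = gen_pow c ((int r + 1) * i)"
          using u by (simp add: algebra_simps)
        then show ?thesis by blast
      next
        fix r J s xs
        assume J: "lin c J = l" "alternating (s # xs)" "xs \<noteq> []" "leaves J s" "fst s = (\<not> c)"
          and us: "F2_prod us = gen_pow c (int r * i + crd c J - x) \<star> ev (s # xs)"
        have "F2_prod (u # us) = gen_pow c (int (Suc r) * i + crd c J - x) \<star> ev (s # xs)"
          using u us by (simp add: algebra_simps)
        with J show ?thesis by blast
      qed
    next
      fix J K s xs t
      assume JK: "J \<in> Js" "K \<in> Js" "lin c J = l" "lin c K = l"
        and alt: "alternating (s # xs @ [t])" "xs \<noteq> []" and s: "leaves J s" "fst s = (\<not> c)"
        and t: "arrives K t" "fst t = (\<not> c)"
        and u: "u = gen_pow c (crd c J - x) \<star> ev (s # xs @ [t]) \<star> gen_pow c (y - crd c K)"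
      have long: "?long (u # us)"
        if "F2_prod (u # us) = gen_pow c (crd c J - x) \<star> ev (s # zs)" "alternating (s # zs)" "zs \<noteq> []" for zs
        using that JK s by (intro disjI2 exI[of _ "0::nat"] exI[of _ J] exI[of _ s] exI[of _ zs]) simp
      from IH show ?thesis
      proof (elim disjE exE conjE)
        fix r assume us: "F2_prod us = gen_pow c (int r * i)"
        define n where "n = y - crd c K + int r * i"
        have prod: "F2_prod (u # us) = gen_pow c (crd c J - x) \<star> ev (s # xs @ [t]) \<star> gen_pow c n"
          using u us by (simp add: F2.m_assoc n_def)
        show ?thesis
        proof (cases "n = 0")
          case True
          then show ?thesis using long[of "xs @ [t]"] prod alt by simp
        next
          case False
          have "ev (s # xs @ [t]) \<star> gen_pow c n = ev (s # xs @ [t, (c, n)])"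
            using ev_append[of "s # xs @ [t]" "[(c, n)]"] by (simp add: ev_Cons)
          moreover have "alternating ((s # xs @ [t]) @ [(c, n)])"
            unfolding alternating_append[of "s # xs @ [t]"] using alt t False by (simp add: alternating_Cons[of "(c, n)"])
          ultimately show ?thesis
            using long[of "xs @ [t, (c, n)]"] prod by simp
        qed
      next
        fix r J' s' xs'
        assume J': "lin c J' = l" "alternating (s' # xs')" "xs' \<noteq> []" "leaves J' s'" "fst s' = (\<not> c)"
          and us: "F2_prod us = gen_pow c (int r * i + crd c J' - x) \<star> ev (s' # xs')"
        \<comment> \<open>This is \<open>(y - crd c K) + (int r * i + crd c J' - x)\<close>; the
          difference \<open>y - x\<close> counts as one more \<open>i\<close>.\<close>
        define n where "n = int (Suc r) * i + (crd c J' - crd c K)"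
        have prod: "F2_prod (u # us) = gen_pow c (crd c J - x) \<star> ev (s # xs @ [t]) \<star> gen_pow c n \<star> ev (s' # xs')"
          using u us by (simp add: F2.m_assoc n_def i_def algebra_simps)
        show ?thesis
        proof (cases "n = 0")
          case False
          have "ev (s # xs @ [t]) \<star> gen_pow c n \<star> ev (s' # xs') = ev (s # xs @ t # (c, n) # s' # xs')"
            using ev_append[of "s # xs @ [t]" "(c, n) # s' # xs'"] by (simp add: ev_Cons)
          moreover have "alternating ((s # xs @ [t]) @ (c, n) # s' # xs')"
            unfolding alternating_append[of "s # xs @ [t]"]
            using alt t J' False by (simp add: alternating_Cons[of "(c, n)"])
          ultimately show ?thesis
            using long[of "xs @ t # (c, n) # s' # xs'"] prod by simp
        next
          case True
          then have "int (Suc r) * i = crd c K - crd c J'" by (simp add: n_def)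
          moreover have "int (Suc r) * i \<noteq> 0" using i by simp
          ultimately have "K \<noteq> J'" by auto
          then have "snd t + snd s' \<noteq> 0"
            using arrives_leaves_no_cancel[OF t(1) J'(4)] t J' by auto
          moreover obtain a b where ab: "t = (\<not> c, a)" "s' = (\<not> c, b)"
            using t(2) J'(5) by (cases t; cases s') auto
          ultimately have sum: "a + b \<noteq> 0" by simp
          have "ev (s # xs @ [t]) \<star> ev (s' # xs') = ev (s # xs @ (\<not> c, a + b) # xs')"
            using ev_append[of "s # xs" "[t]"] ev_append[of "s # xs" "(\<not> c, a + b) # xs'"]
            by (simp add: ab ev_Cons F2.m_assoc)
          moreover have "alternating ((s # xs) @ (\<not> c, a + b) # xs')"
            using alt J'(2) sum unfolding ab alternating_append[of "s # xs"] append_Cons[symmetric]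
            by (simp add: alternating_Cons[of "(_, _)"])
          ultimately show ?thesis
            using long[of "xs @ (\<not> c, a + b) # xs'"] prod True alt(2) by simp
        qed
      qed
    qed
  qed simp
  then show "F2_prod us \<noteq> \<one>\<^bsub>F2\<^esub>"
  proof (elim disjE exE conjE)
    fix r assume "F2_prod us = gen_pow c ((int r + 1) * i)"
    moreover have "(int r + 1) * i \<noteq> 0" using i by simp
    ultimately show ?thesis using words_from_to_neq_one[OF gen_pow_in_words] by metis
  next
    fix r J s xs
    assume "F2_prod us = gen_pow c (int r * i + crd c J - x) \<star> ev (s # xs)"
      "alternating (s # xs)" "fst s = (\<not> c)"
    then show ?thesis
      using gen_pow_words_neq_one[OF words_from_toI[of "s # xs"], of c _ _ "int r * i + crd c J - x" 0] by auto
  qed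
qed

text \<open>If junctions \<open>J\<close> on \<open>l\<close> and \<open>K\<close> on
  \<open>l'\<close> have the same offset from the two vertices, one power of \<open>c\<close> moves
  the vertices to \<open>J\<close> and \<open>K\<close> simultaneously and conjugates all labels. If
  \<open>J\<close> and \<open>K\<close> then share a line of the other letter, the case of a single
  line returns.\<close>

lemma positive_free_parallel:
  assumes distinct: "\<not> conn (c, l, x) \<one>\<^bsub>F2\<^esub> (c, l', y)"
  shows "positive_free {u. conn (c, l, x) u (c, l', y)}"
proof (cases "l = l'")
  case True
  then have "x \<noteq> y" using distinct conn_refl by auto
  then show ?thesis unfolding True by (rule positive_free_same_line)
next
  case False
  show ?thesis
  proof (cases "\<exists>J K. J \<in> Js \<and> K \<in> Js \<and> lin c J = l \<and> lin c K = l' \<and> crd c J - x = crd c K - y")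
    case True
    then obtain J K where JK: "J \<in> Js" "K \<in> Js" "lin c J = l" "lin c K = l'" "crd c J - x = crd c K - y"
      by blast
    let ?U = "{u. conn (c, lin c J, crd c J) u (c, lin c K, crd c K)}"
    have free: "positive_free ?U"
    proof (cases "lin (\<not> c) J = lin (\<not> c) K")
      case True
      have "crd (\<not> c) J \<noteq> crd (\<not> c) K" using crd_inj[of J K "\<not> c"] True JK False by auto
      then have "positive_free {u. conn (\<not> c, lin (\<not> c) J, crd (\<not> c) J) u (\<not> c, lin (\<not> c) K, crd (\<not> c) K)}"
        unfolding True by (rule positive_free_same_line)
      then show ?thesis using JK by (simp only: conn_switch_iff conn_switch_iff_right)
    next
      case off: False
      have "lin d J \<noteq> lin d K" for d
        using off False JK by (cases "d = c") auto
      then show ?thesis using JK by (intro positive_free_junctions)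
    qed
    define n where "n = crd c J - x"
    have ends: "crd c J + - n = x" "y + n = crd c K" using JK by (auto simp: n_def)
    have shift: "conn (c, lin c J, crd c J) (gen_pow c (- n)) (c, l, x)"
      "conn (c, l', y) (gen_pow c n) (c, lin c K, crd c K)"
      using conn_gen_pow[of c l "crd c J" "- n", unfolded ends] conn_gen_pow[of c l' y n, unfolded ends]
      by (simp_all only: JK)
    show ?thesis
    proof (rule positive_free_conj[OF free])
      fix v assume "v \<in> {u. conn (c, l, x) u (c, l', y)}"
      then have v: "conn (c, l, x) v (c, l', y)" by simp
      have "gen_pow c (- n) \<star> v \<star> gen_pow c n \<in> ?U"
        using conn_trans[OF shift(1) conn_trans[OF v shift(2)]] by simp
      moreover have "v = gen_pow c n \<star> (gen_pow c (- n) \<star> v \<star> gen_pow c n) \<star> F2_inv (gen_pow c n)"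
        using conn_closed[OF v] by (simp add: F2.m_assoc)
      ultimately show "\<exists>u\<in>?U. v = gen_pow c n \<star> u \<star> F2_inv (gen_pow c n)" by blast
    qed (use conn_closed in auto)
  qed (use False positive_free_disjoint_lines in blast)
qed

text \<open>A vertex at a junction has names with both letters. So the two vertices can be given the
  same letter, unless neither is a junction and their letters differ.\<close>

lemma positive_free_conn:
  assumes distinct: "\<not> conn Q \<one>\<^bsub>F2\<^esub> P"
  shows "positive_free {u. conn Q u P}"
proof -
  obtain c l x d l' y where QP: "Q = (c, l, x)" "P = (d, l', y)" by (cases Q, cases P) auto
  consider "d = c" | J where "d = (\<not> c)" "J \<in> Js" "lin c J = l" "crd c J = x"
    | J where "d = (\<not> c)" "J \<in> Js" "lin d J = l'" "crd d J = y"
    | "d = (\<not> c)" "\<forall>J\<in>Js. (lin c J, crd c J) \<noteq> (l, x)" "\<forall>J\<in>Js. (lin d J, crd d J) \<noteq> (l', y)"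
    by blast
  then show ?thesis
  proof cases
    case 1
    then show ?thesis using distinct QP positive_free_parallel by simp
  next
    case 2
    then have "conn Q u P \<longleftrightarrow> conn (d, lin d J, crd d J) u (d, l', y)" for u
      using conn_switch_iff[of J c u P] QP by simp
    then show ?thesis using distinct positive_free_parallel by simp
  next
    case 3
    then have "conn Q u P \<longleftrightarrow> conn (c, l, x) u (c, lin c J, crd c J)" for u
      using conn_switch_iff_right[of J Q u c] QP by simp
    then show ?thesis using distinct positive_free_parallel by simp
  next
    case 4
    then show ?thesis using QP positive_free_different_letters by simp
  qed
qed

text \<open>Such a vertex has no name with the letter \<open>c\<close>, so no nontrivial power of
  \<open>c\<close> can be read from it.\<close>

definition blocked :: "bool \<Rightarrow> bool \<times> 'l \<times> int \<Rightarrow> bool" where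
  "blocked c P \<longleftrightarrow> (\<exists>l x. P = (\<not> c, l, x) \<and> (\<forall>J\<in>Js. (lin (\<not> c) J, crd (\<not> c) J) \<noteq> (l, x)))"

lemma not_blocked_conn:
  assumes "\<not> blocked c P" "conn B p P"
  obtains l x where "conn B p (c, l, x)"
proof -
  obtain d l x where P: "P = (d, l, x)" by (cases P) auto
  show thesis
  proof (cases "d = c")
    case True
    then show thesis using assms(2) P that by auto
  next
    case False
    then have d: "d = (\<not> c)" by simp
    then obtain J where "J \<in> Js" "lin d J = l" "crd d J = x"
      using assms(1) P unfolding blocked_def by auto
    then have "conn B p (c, lin c J, crd c J)"
      using conn_switch_iff_right[of J B p c] assms(2) P d by simp
    then show thesis by (rule that)
  qed
qed

text \<open>While an end is not blocked, the outer syllable of \<open>xs\<close> there can be read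
  in the graph and passes into \<open>p\<close> or \<open>q\<close>. Each such step shortens
  \<open>xs\<close>.\<close>

lemma reduced_decomposition:
  assumes "conn B p P" "conn B q Q" "alternating xs" "g = p \<star> ev xs \<star> F2_inv q"
  shows "\<exists>p P q Q ys. conn B p P \<and> conn B q Q \<and> alternating ys \<and> g = p \<star> ev ys \<star> F2_inv q \<and>
    (ys \<noteq> [] \<longrightarrow> blocked (fst (hd ys)) P \<and> blocked (fst (last ys)) Q)"
  using assms
proof (induction "length xs" arbitrary: p P q Q xs rule: less_induct)
  case less
  have [simp]: "p \<in> carrier F2" "q \<in> carrier F2" using less.prems conn_closed by auto
  consider "xs = []" | "xs \<noteq> []" "blocked (fst (hd xs)) P" "blocked (fst (last xs)) Q"
    | "xs \<noteq> []" "\<not> blocked (fst (hd xs)) P" | "xs \<noteq> []" "\<not> blocked (fst (last xs)) Q"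
    by blast
  then show ?case
  proof cases
    case 3
    then obtain c n ys where xs: "xs = (c, n) # ys" by (cases xs) auto
    obtain l x where "conn B p (c, l, x)"
      using not_blocked_conn[OF _ less.prems(1), of c] 3 xs by auto
    then have "conn B (p \<star> gen_pow c n) (c, l, x + n)"
      using conn_gen_pow conn_trans by blast
    moreover have "g = (p \<star> gen_pow c n) \<star> ev ys \<star> F2_inv q"
      using less.prems(4) by (simp add: xs ev_Cons F2.m_assoc)
    ultimately show ?thesis
      using less.prems(2,3) by (intro less.hyps) (simp_all add: xs alternating_Cons)
  next
    case 4
    then obtain c n ys where xs: "xs = ys @ [(c, n)]" by (cases xs rule: rev_cases) auto
    obtain l x where "conn B q (c, l, x)"
      using not_blocked_conn[OF _ less.prems(2), of c] 4 xs by auto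
    then have "conn B (q \<star> gen_pow c (- n)) (c, l, x - n)"
      using conn_gen_pow[of c l x "- n"] conn_trans by fastforce
    moreover have "g = p \<star> ev ys \<star> F2_inv (q \<star> gen_pow c (- n))"
      using less.prems(4) by (simp add: xs ev_Cons ev_append F2.m_assoc F2.inv_mult_group)
    ultimately show ?thesis
      using less.prems(1,3) by (intro less.hyps) (simp_all add: xs alternating_append)
  next
    case 1
    show ?thesis
      by (intro exI conjI) (fact less.prems | simp add: 1)+
  next
    case 2
    show ?thesis
      by (intro exI conjI) (fact less.prems | simp add: 2)+
  qed
qed

text \<open>Up to conjugation by \<open>p\<close>, the product of \<open>g\<close> and
  \<open>h\<close> is \<open>ev ys\<close> followed by the product of \<open>F2_inv q\<close>,
  \<open>h\<close> and \<open>p\<close>, which labels a path from \<open>Q\<close> to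
  \<open>P\<close>. Either \<open>ys\<close> is empty or both its ends are blocked.\<close>

theorem positive_free_loops_coset:
  assumes "g \<in> carrier F2" "\<not> conn B g B"
  shows "positive_free ((\<star>) g ` {h. conn B h B})"
proof -
  obtain xs where "alternating xs" "g = ev xs" using assms(1) by (rule alternating_form)
  then have "g = \<one>\<^bsub>F2\<^esub> \<star> ev xs \<star> F2_inv \<one>\<^bsub>F2\<^esub>" by simp
  from reduced_decomposition[OF conn_refl conn_refl \<open>alternating xs\<close> this, of B]
  obtain p P q Q ys where p: "conn B p P" and q: "conn B q Q" and ys: "alternating ys"
    and g: "g = p \<star> ev ys \<star> F2_inv q"
    and ends: "ys \<noteq> [] \<longrightarrow> blocked (fst (hd ys)) P \<and> blocked (fst (last ys)) Q"
    by blast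
  have [simp]: "p \<in> carrier F2" "q \<in> carrier F2" using p q conn_closed by auto
  have "positive_free ((\<star>) (ev ys) ` {u. conn Q u P})"
  proof (cases "ys = []")
    case True
    \<comment> \<open>Otherwise \<open>g\<close>, now the product of \<open>p\<close> and
      \<open>F2_inv q\<close>, would itself label a closed path at \<open>B\<close>.\<close>
    have "\<not> conn Q \<one>\<^bsub>F2\<^esub> P"
    proof
      assume QP: "conn Q \<one>\<^bsub>F2\<^esub> P"
      have "conn B (p \<star> F2_inv \<one>\<^bsub>F2\<^esub> \<star> F2_inv q) B"
        by (rule conn_trans[OF p conn_trans[OF conn_inv[OF QP] conn_inv[OF q]]])
      with True g assms(2) show False by simp
    qed
    moreover have "(\<star>) (ev ys) ` {u. conn Q u P} = {u. conn Q u P}"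
    proof -
      have "ev ys \<star> u = u" if "conn Q u P" for u
        using conn_closed[OF that] True by simp
      then show ?thesis by (simp add: image_def)
    qed
    ultimately show ?thesis by (simp add: positive_free_conn)
  next
    case False
    with ends have "blocked (fst (hd ys)) P" "blocked (fst (last ys)) Q" by auto
    then obtain l x l' y where Q: "Q = (\<not> fst (last ys), l, x)" and P: "P = (\<not> fst (hd ys), l', y)"
      and "\<And>J. J \<in> Js \<Longrightarrow> (lin (\<not> fst (last ys)) J, crd (\<not> fst (last ys)) J) \<noteq> (l, x)"
      and "\<And>J. J \<in> Js \<Longrightarrow> (lin (\<not> fst (hd ys)) J, crd (\<not> fst (hd ys)) J) \<noteq> (l', y)"
      unfolding blocked_def by (elim exE conjE) simp
    moreover have "ev ys \<in> words_from_to (\<not> \<not> fst (hd ys)) (\<not> \<not> fst (last ys))"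
      using ys False by (intro words_from_toI[of ys]) auto
    ultimately show ?thesis unfolding P Q by (intro positive_free_outside)
  qed
  then show ?thesis
  proof (rule positive_free_conj)
    fix v assume "v \<in> (\<star>) g ` {h. conn B h B}"
    then obtain h where h: "conn B h B" "v = g \<star> h" by auto
    then have [simp]: "h \<in> carrier F2" using conn_closed by auto
    have u: "F2_inv q \<star> h \<star> p \<in> {u. conn Q u P}"
      by (rule CollectI, rule conn_trans[OF conn_inv[OF q] conn_trans[OF h(1) p]])
    have "v = p \<star> (ev ys \<star> (F2_inv q \<star> h \<star> p)) \<star> F2_inv p"
      unfolding h(2) g by (simp add: F2.m_assoc)
    then show "\<exists>u\<in>(\<star>) (ev ys) ` {u. conn Q u P}. v = p \<star> u \<star> F2_inv p"
      by (rule bexI[OF _ imageI[OF u]])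
  next
    show "(\<star>) (ev ys) ` {u. conn Q u P} \<subseteq> carrier F2"
      using conn_closed[of Q _ P] by (intro image_subsetI) simp
  qed simp
qed

section \<open>Path labels and membership in a subgroup\<close>

lemma conn_segment:
  assumes "J \<in> Js" "K \<in> Js" "lin c J = lin c K"
  shows "conn (c, lin c J, crd c J) (gen_pow c (crd c K - crd c J)) (c, lin c K, crd c K)"
  using conn_gen_pow[of c "lin c J" "crd c J" "crd c K - crd c J"] assms by simp

text \<open>\<open>pos\<close> gives each vertex name a representative of a right coset of
  \<open>C\<close>, and reading a label multiplies cosets on the right. Moves along a line respect
  this by the form of \<open>pos\<close>, so only the two names of a junction have to be
  compared.\<close>

lemma conn_in_subgroup:
  fixes start :: "bool \<Rightarrow> 'l \<Rightarrow> letter list"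
  defines "pos \<equiv> \<lambda>(c, l, x). start c l \<star> gen_pow c x"
  assumes C: "subgroup C F2" and [simp]: "\<And>c l. start c l \<in> carrier F2"
    and junction: "\<And>J. J \<in> Js \<Longrightarrow>
      pos (False, lin False J, crd False J) \<star> F2_inv (pos (True, lin True J, crd True J)) \<in> C"
  shows "conn P u Q \<Longrightarrow> pos P \<star> u \<star> F2_inv (pos Q) \<in> C"
proof (induction rule: conn.induct)
  have [simp]: "pos P \<in> carrier F2" for P by (auto simp: pos_def split: prod.splits)
  {
    case (conn_refl P)
    show ?case using subgroup.one_closed[OF C] by simp
  next
    case (conn_move c l x n u P)
    have [simp]: "u \<in> carrier F2" using conn_move.hyps by (rule conn_closed)
    have "pos (c, l, x) \<star> (gen_pow c n \<star> u) \<star> F2_inv (pos P) = pos (c, l, x + n) \<star> u \<star> F2_inv (pos P)"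
      by (simp add: pos_def F2.m_assoc split: prod.splits)
    then show ?case
      using conn_move.IH by simp
  next
    case (conn_switch J c u P)
    let ?P = "pos (c, lin c J, crd c J)" and ?Q = "pos (\<not> c, lin (\<not> c) J, crd (\<not> c) J)"
    have [simp]: "u \<in> carrier F2" using conn_switch.hyps(2) by (rule conn_closed)
    have "?P \<star> F2_inv ?Q \<in> C"
    proof (cases c)
      case True
      then show ?thesis
        using subgroup.m_inv_closed[OF C junction[OF conn_switch.hyps(1)]] by (simp add: F2.inv_mult_group)
    qed (use junction conn_switch.hyps(1) in simp)
    then have "(?P \<star> F2_inv ?Q) \<star> (?Q \<star> u \<star> F2_inv (pos P)) \<in> C"
      using conn_switch.IH subgroup.m_closed[OF C] by blast
    moreover have "F2_inv ?Q \<star> ?Q \<star> u \<star> F2_inv (pos P) = u \<star> F2_inv (pos P)"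
      by (simp flip: F2.m_assoc)
    ultimately show ?case by (simp add: F2.m_assoc)
  }
qed

end

lemma RTF_F2I:
  assumes "\<And>g. g \<in> carrier F2 \<Longrightarrow> g \<notin> H \<Longrightarrow> positive_free ((\<star>) g ` H)"
  shows "RTF F2 H"
  unfolding RTF_def
proof (intro ballI allI impI)
  fix g h and k :: nat
  assume "g \<in> carrier F2 - H" "1 \<le> k" "\<forall>i\<in>{1..k}. h i \<in> H"
  then have "positive_free ((\<star>) g ` H)" "map (\<lambda>i. g \<star> h i) [1..<Suc k] \<noteq> []"
    "set (map (\<lambda>i. g \<star> h i) [1..<Suc k]) \<subseteq> (\<star>) g ` H"
    using assms[of g] by auto
  then have "F2_prod (map (\<lambda>i. g \<star> h i) [1..<Suc k]) \<noteq> \<one>\<^bsub>F2\<^esub>"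
    unfolding positive_free_def by blast
  then show "foldr (\<lambda>i acc. (g \<star> h i) \<star> acc) [1..<Suc k] \<one>\<^bsub>F2\<^esub> \<noteq> \<one>\<^bsub>F2\<^esub>"
    by (simp add: foldr_map comp_def del: upt_Suc)
qed

section \<open>The bouquet of the words alpha\<close>

text \<open>\<open>MidA i j\<close> and \<open>MidB i j\<close> are the vertices reached on the \<open>i\<close>-th loop after its \<open>j\<close>-th
\<open>a\<close>-syllable and \<open>j\<close>-th \<open>b\<close>-syllable. The lines \<open>(0, 0)\<close> through \<open>Base\<close> carry all first
\<open>a\<close>-syllables and all last \<open>b\<close>-syllables, respectively, which is where folding takes place.\<close>

datatype junction = Base | MidA nat nat | MidB nat nat

text \<open>There is no \<open>MidB i s\<close>, since the last \<open>b\<close>-syllable of every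
  loop ends at \<open>Base\<close>.\<close>

definition junctions :: "nat \<Rightarrow> nat \<Rightarrow> junction set" where
  "junctions m s = insert Base ((\<lambda>(i, j). MidA i j) ` ({1..m} \<times> {1..s}) \<union> (\<lambda>(i, j). MidB i j) ` ({1..m} \<times> {1..<s}))"

lemma in_junctions [simp]:
  "Base \<in> junctions m s"
  "MidA i j \<in> junctions m s \<longleftrightarrow> i \<in> {1..m} \<and> j \<in> {1..s}"
  "MidB i j \<in> junctions m s \<longleftrightarrow> i \<in> {1..m} \<and> j \<in> {1..<s}"
  by (auto simp: junctions_def)

text \<open>Away from \<open>Base\<close>, \<open>(i, j)\<close> names the line that carries the
  \<open>j\<close>-th syllable in its letter of the \<open>i\<close>-th loop. Loop indices start at
  1, so \<open>(0, 0)\<close> causes no clash.\<close>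

fun line :: "nat \<Rightarrow> bool \<Rightarrow> junction \<Rightarrow> nat \<times> nat" where
  "line s c Base = (0, 0)"
| "line s False (MidA i j) = (if j = 1 then (0, 0) else (i, j))"
| "line s True (MidA i j) = (if j = s then (0, 0) else (i, j))"
| "line s False (MidB i j) = (i, Suc j)"
| "line s True (MidB i j) = (i, j)"

text \<open>Off the lines through \<open>Base\<close>, the origin is the start of the syllable. The
  last \<open>b\<close>-syllables end at \<open>Base\<close>, whose coordinate is 0, hence the minus
  sign.\<close>

fun coord :: "(nat \<Rightarrow> nat \<Rightarrow> int) \<Rightarrow> (nat \<Rightarrow> nat \<Rightarrow> int) \<Rightarrow> nat \<Rightarrow> bool \<Rightarrow> junction \<Rightarrow> int" where
  "coord k1 k2 s c Base = 0"
| "coord k1 k2 s False (MidA i j) = k1 i j"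
| "coord k1 k2 s True (MidA i j) = (if j = s then - k2 i s else 0)"
| "coord k1 k2 s False (MidB i j) = 0"
| "coord k1 k2 s True (MidB i j) = k2 i j"

text \<open>\<open>Inl\<close> stands for the syllables, \<open>Inr\<close> for the pairs of far
  ends of first \<open>a\<close>-syllables or last \<open>b\<close>-syllables on a line through
  \<open>Base\<close>. This is the index set of condition (A).\<close>

fun seg_ends :: "nat \<Rightarrow> bool \<Rightarrow> (nat \<times> nat) + (nat \<times> nat) \<Rightarrow> junction set" where
  "seg_ends s False (Inl (i, j)) = {if j = 1 then Base else MidB i (j - 1), MidA i j}"
| "seg_ends s False (Inr (i, i')) = {MidA i 1, MidA i' 1}"
| "seg_ends s True (Inl (i, j)) = {MidA i j, if j = s then Base else MidB i j}"
| "seg_ends s True (Inr (i, i')) = {MidA i s, MidA i' s}"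

definition seg_index :: "nat \<Rightarrow> nat \<Rightarrow> ((nat \<times> nat) + (nat \<times> nat)) set" where
  "seg_index m s = Inl ` ({1..m} \<times> {1..s}) \<union> Inr ` {(i, i'). 1 \<le> i \<and> i < i' \<and> i' \<le> m}"

lemma in_seg_index [simp]:
  "Inl (i, j) \<in> seg_index m s \<longleftrightarrow> i \<in> {1..m} \<and> j \<in> {1..s}"
  "Inr (i, i') \<in> seg_index m s \<longleftrightarrow> 1 \<le> i \<and> i < i' \<and> i' \<le> m"
  by (auto simp: seg_index_def)

definition seg_length :: "(nat \<Rightarrow> nat \<Rightarrow> int) \<Rightarrow> nat \<Rightarrow> (nat \<times> nat) + (nat \<times> nat) \<Rightarrow> int" where
  "seg_length k e x = (case x of Inl (i, j) \<Rightarrow> \<bar>k i j\<bar> | Inr (i, i') \<Rightarrow> \<bar>k i e - k i' e\<bar>)"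

text \<open>A zero difference would make two syllables of different loops equally long, against
  injectivity.\<close>

lemma seg_length_nonzero:
  assumes "inj_on (seg_length k e) (seg_index m s)" "\<forall>i\<in>{1..m}. \<forall>j\<in>{1..s}. k i j \<noteq> 0" "e \<in> {1..s}"
    and x: "x \<in> seg_index m s"
  shows "seg_length k e x \<noteq> 0"
proof (cases x)
  case (Inl a)
  then show ?thesis using assms(2) x by (auto simp: seg_index_def seg_length_def)
next
  case (Inr a)
  then obtain i i' where ii': "x = Inr (i, i')" "1 \<le> i" "i < i'" "i' \<le> m"
    using x by (auto simp: seg_index_def)
  have "seg_length k e (Inl (i, e)) \<noteq> seg_length k e (Inl (i', e))"
    using ii' assms(3) inj_onD[OF assms(1), of "Inl (i, e)" "Inl (i', e)"] by (auto simp: seg_index_def)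
  then show ?thesis using ii' by (auto simp: seg_length_def)
qed

lemma segment_cases:
  assumes "J \<in> junctions m s" "K \<in> junctions m s" "J \<noteq> K" "line s c J = line s c K"
  shows "\<exists>x\<in>seg_index m s. {J, K} = seg_ends s c x \<and>
    \<bar>coord k1 k2 s c K - coord k1 k2 s c J\<bar> = seg_length (if c then k2 else k1) (if c then s else 1) x"
    (is "?P J K")
proof -
  \<comment> \<open>A line carries at most one junction that is not a \<open>MidA\<close>, and two
    of kind \<open>MidA\<close> on it belong to different loops. So up to exchange the second
    junction is a \<open>MidA\<close> with the larger loop index.\<close>
  have to_MidA: "?P J (MidA i j)"
    if "J \<in> junctions m s" "MidA i j \<in> junctions m s" "line s c J = line s c (MidA i j)"
      "\<And>i' j'. J = MidA i' j' \<Longrightarrow> i' < i" for J i j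
  proof (cases J)
    case (MidA i' j')
    then have j: "j = (if c then s else 1)" "j' = (if c then s else 1)" "i' < i"
      using that by (cases c; auto split: if_splits)+
    with MidA that(1,2) show ?thesis
      by (intro bexI[of _ "Inr (i', i)"]) (cases c; auto simp: seg_length_def)+
  next
    case Base
    with that show ?thesis
      by (intro bexI[of _ "Inl (i, j)"]) (cases c; auto simp: seg_length_def split: if_splits)+
  next
    case (MidB i' j')
    with that show ?thesis
      by (intro bexI[of _ "Inl (i, j)"]) (cases c; auto simp: seg_length_def split: if_splits)+
  qed
  have sym: "?P K J \<Longrightarrow> ?P J K"
    by (simp only: insert_commute[of K J] abs_minus_commute)
  show ?thesis
  proof (cases "\<exists>i j. K = MidA i j \<and> (\<forall>i' j'. J = MidA i' j' \<longrightarrow> i' < i)")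
    case True
    then show ?thesis using to_MidA assms by blast
  next
    case False
    have "\<exists>i j. J = MidA i j \<and> (\<forall>i' j'. K = MidA i' j' \<longrightarrow> i' < i)"
      using assms False by (cases J; cases K; cases c) (auto split: if_splits)
    then show ?thesis using sym to_MidA assms by metis
  qed
qed

text \<open>An explicit inverse to the pair of line names. For \<open>s = 1\<close> every
  \<open>MidA i 1\<close> would share both its lines with \<open>Base\<close>.\<close>

lemma junction_of_lines:
  assumes "2 \<le> s" "J \<in> junctions m s"
  shows "J = (let a = line s False J; b = line s True J in
    if a = (0, 0) then (if b = (0, 0) then Base else case_prod MidA b)
    else if b = (0, 0) \<or> a = b then case_prod MidA a else case_prod MidB b)"
  using assms by (cases J) (auto simp: Let_def)

lemma junction_graph_bouquet:
  assumes s: "2 \<le> s" and nonzero: "\<forall>i\<in>{1..m}. \<forall>j\<in>{1..s}. k1 i j \<noteq> 0 \<and> k2 i j \<noteq> 0"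
    and inj: "inj_on (seg_length k1 1) (seg_index m s)" "inj_on (seg_length k2 s) (seg_index m s)"
  shows "junction_graph (junctions m s) (line s) (coord k1 k2 s)"
proof
  fix J J' K K' c
  assume in_junctions: "J \<in> junctions m s" "J' \<in> junctions m s" "K \<in> junctions m s" "K' \<in> junctions m s"
    and J: "J \<noteq> J'" "line s c J = line s c J'" and K: "line s c K = line s c K'"
    and eq: "coord k1 k2 s c J' - coord k1 k2 s c J = coord k1 k2 s c K' - coord k1 k2 s c K"
  let ?len = "seg_length (if c then k2 else k1) (if c then s else 1)"
  have inj_len: "inj_on ?len (seg_index m s)" using inj by auto
  obtain x where x: "x \<in> seg_index m s" "{J, J'} = seg_ends s c x"
    "\<bar>coord k1 k2 s c J' - coord k1 k2 s c J\<bar> = ?len x"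
    using segment_cases[OF in_junctions(1,2) J, of k1 k2] by blast
  have "?len x \<noteq> 0"
    by (rule seg_length_nonzero[OF inj_len]) (use nonzero s x in auto)
  with x eq have diff: "coord k1 k2 s c J' - coord k1 k2 s c J \<noteq> 0" by auto
  with eq have "K \<noteq> K'" by auto
  then obtain y where y: "y \<in> seg_index m s" "{K, K'} = seg_ends s c y"
    "\<bar>coord k1 k2 s c K' - coord k1 k2 s c K\<bar> = ?len y"
    using segment_cases[OF in_junctions(3,4) _ K, of k1 k2] by blast
  have "x = y" using inj_onD[OF inj_len, of x y] x y eq by simp
  then have "{J, J'} = {K, K'}" using x y by simp
  \<comment> \<open>The opposite matching of the ends would reverse the sign of the displacement,
    which is not zero.\<close>
  then show "J = K" using diff eq by (auto simp: doubleton_eq_iff)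
next
  fix J K c
  assume "J \<in> junctions m s" "K \<in> junctions m s" "line s c J = line s c K" "line s (\<not> c) J = line s (\<not> c) K"
  then have "line s False J = line s False K" "line s True J = line s True K"
    by (cases c; simp)+
  with \<open>J \<in> _\<close> \<open>K \<in> _\<close> show "J = K"
    using junction_of_lines[OF s] by metis
qed

section \<open>Labels of closed paths at the base and the subgroup generated by the words
  alpha\<close>

definition blocks :: "(nat \<Rightarrow> nat \<Rightarrow> int) \<Rightarrow> (nat \<Rightarrow> nat \<Rightarrow> int) \<Rightarrow> nat \<Rightarrow> nat \<Rightarrow> letter list" where
  "blocks k1 k2 i j = ev (concat (map (\<lambda>t. [(False, k1 i t), (True, k2 i t)]) [1..<Suc j]))"

lemma blocks_0 [simp]: "blocks k1 k2 i 0 = \<one>\<^bsub>F2\<^esub>"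
  by (simp add: blocks_def)

lemma blocks_Suc: "blocks k1 k2 i (Suc j) = blocks k1 k2 i j \<star> gen_pow False (k1 i (Suc j)) \<star> gen_pow True (k2 i (Suc j))"
  by (simp add: blocks_def ev_append ev_Cons)

lemma blocks_closed [simp]: "blocks k1 k2 i j \<in> carrier F2"
  by (simp add: blocks_def)

lemma alpha_eq_blocks: "alpha k1 k2 s i = blocks k1 k2 i s"
proof -
  have "concat (map (\<lambda>j. gen_pow False (k1 i j) @ gen_pow True (k2 i j)) js)
      = concat (map (\<lambda>(c, n). gen_pow c n) (concat (map (\<lambda>t. [(False, k1 i t), (True, k2 i t)]) js)))" for js
    by (induction js) auto
  then show ?thesis by (simp only: alpha_def blocks_def ev_def)
qed

locale bouquet_graph = junction_graph "junctions m s" "line s" "coord k1 k2 s" for m s k1 k2 +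
  assumes s: "2 \<le> s"
begin

lemma alpha_loop:
  assumes i: "i \<in> {1..m}"
  shows "conn (False, (0, 0), 0) (alpha k1 k2 s i) (False, (0, 0), 0)"
proof -
  \<comment> \<open>The vertex after \<open>j\<close> blocks of the \<open>i\<close>-th loop; the
    loop closes up at \<open>j = s\<close>.\<close>
  define node where "node j = (if j = 0 \<or> j = s then Base else MidB i j)" for j
  have node_in: "node j \<in> junctions m s" if "j \<le> s" for j
    using that i by (auto simp: node_def junctions_def)
  have "conn (False, (0, 0), 0) (blocks k1 k2 i j) (False, line s False (node j), coord k1 k2 s False (node j))"
    if "j \<le> s" for j
    using that
  proof (induction j)
    case 0
    show ?case using conn_refl by (simp add: node_def)
  next
    case (Suc j)
    let ?A = "MidA i (Suc j)"
    have A: "?A \<in> junctions m s" using i Suc.prems by simp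
    have "conn (False, line s False (node j), coord k1 k2 s False (node j)) (gen_pow False (k1 i (Suc j))) (False, line s False ?A, coord k1 k2 s False ?A)"
      using conn_segment[OF node_in A, of j False] Suc.prems by (auto simp: node_def)
    moreover have "conn (True, line s True ?A, coord k1 k2 s True ?A) (gen_pow True (k2 i (Suc j))) (True, line s True (node (Suc j)), coord k1 k2 s True (node (Suc j)))"
      using conn_segment[OF A node_in, of "Suc j" True] Suc.prems by (auto simp: node_def)
    ultimately have "conn (False, line s False (node j), coord k1 k2 s False (node j))
        (gen_pow False (k1 i (Suc j)) \<star> gen_pow True (k2 i (Suc j))) (False, line s False (node (Suc j)), coord k1 k2 s False (node (Suc j)))"
      using conn_trans conn_switch_iff[OF A, of False] conn_switch_iff_right[OF node_in, of "Suc j" _ _ False] Suc.prems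
      by auto
    then show ?case
      using Suc conn_trans by (auto simp: blocks_Suc)
  qed
  from this[of s] show ?thesis
    by (simp add: alpha_eq_blocks node_def)
qed

lemma loop_in_generate:
  assumes loop: "conn (False, (0, 0), 0) g (False, (0, 0), 0)"
  shows "g \<in> generate F2 (alpha k1 k2 s ` {1..m})"
proof -
  define C where "C = generate F2 (alpha k1 k2 s ` {1..m})"
  have C: "subgroup C F2"
    unfolding C_def by (rule F2.generate_is_subgroup) (auto simp: alpha_eq_blocks)
  have alpha_in: "alpha k1 k2 s i \<in> C" if "i \<in> {1..m}" for i
    unfolding C_def using that by (intro generate.incl) auto
  \<comment> \<open>The word read along the \<open>i\<close>-th loop from \<open>Base\<close> to the
    origin of the line: \<open>j - 1\<close> full blocks, and for a \<open>b\<close>-line one more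
    \<open>a\<close>-syllable.\<close>
  define start where "start c l = (case l of (i, j) \<Rightarrow> if l = (0, 0) then \<one>\<^bsub>F2\<^esub>
      else blocks k1 k2 i (j - 1) \<star> (if c then gen_pow False (k1 i j) else \<one>\<^bsub>F2\<^esub>))"
    for c and l :: "nat \<times> nat"
  have [simp]: "start c l \<in> carrier F2" for c l
    by (auto simp: start_def split: prod.splits)
  have one: "\<one>\<^bsub>F2\<^esub> \<in> C" using C by (rule subgroup.one_closed)
  have "(\<lambda>(c, l, x). start c l \<star> gen_pow c x) (False, line s False J, coord k1 k2 s False J) \<star>
      F2_inv ((\<lambda>(c, l, x). start c l \<star> gen_pow c x) (True, line s True J, coord k1 k2 s True J)) \<in> C" if "J \<in> junctions m s" for J
  proof (cases J)
    case Base
    then show ?thesis using one by (simp add: start_def)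
  next
    case (MidA i j)
    then have ij: "1 \<le> i" "i \<le> m" "1 \<le> j" "j \<le> s" using that by auto
    then obtain j' where j': "j = Suc j'" by (cases j) auto
    have a: "start False (line s False J) \<star> gen_pow False (coord k1 k2 s False J) = blocks k1 k2 i j' \<star> gen_pow False (k1 i j)"
      using ij MidA j' by (auto simp: start_def)
    show ?thesis
    proof (cases "j = s")
      case False
      then have "start True (line s True J) \<star> gen_pow True (coord k1 k2 s True J) = blocks k1 k2 i j' \<star> gen_pow False (k1 i j)"
        using ij MidA j' by (auto simp: start_def)
      then show ?thesis using a one by simp
    next
      case True
      \<comment> \<open>Only at these junctions do the two names have different representatives;
        their quotient is the generator \<open>alpha k1 k2 s i\<close>.\<close>
      have "start False (line s False J) \<star> gen_pow False (coord k1 k2 s False J) \<star> gen_pow True (k2 i s) = alpha k1 k2 s i"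
        using True j' blocks_Suc[of k1 k2 i j'] by (simp add: alpha_eq_blocks F2.m_assoc a flip: F2.m_assoc[of "start False (line s False J)"])
      then show ?thesis
        using True MidA alpha_in[of i] ij by (simp add: start_def F2.m_assoc)
    qed
  next
    case (MidB i j)
    then have ij: "1 \<le> i" "i \<le> m" "1 \<le> j" "j < s" using that by auto
    then obtain j' where "j = Suc j'" by (cases j) auto
    then show ?thesis using ij MidB one by (simp add: start_def blocks_Suc F2.m_assoc F2.inv_mult_group)
  qed
  from conn_in_subgroup[OF C \<open>\<And>l c. start c l \<in> carrier F2\<close> this loop] show ?thesis
    using conn_closed[OF loop] by (simp add: start_def C_def[symmetric] del: One_nat_def)
qed

end

theorem mainTheorem5:
  fixes m s :: nat and k1 k2 :: "nat \<Rightarrow> nat \<Rightarrow> int" and eps :: "nat \<Rightarrow> nat \<Rightarrow> int"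
  assumes m: "m \<ge> 8" and s: "s \<ge> 10"
    and nonzero: "\<forall>i\<in>{1..m}. \<forall>j\<in>{1..s}. k1 i j \<noteq> 0 \<and> k2 i j \<noteq> 0"
    and A1: "inj_on (\<lambda>x. case x of Inl (i, j) \<Rightarrow> \<bar>k1 i j\<bar>
                                 | Inr (i, i') \<Rightarrow> \<bar>k1 i 1 - k1 i' 1\<bar>)
               (Inl ` ({1..m} \<times> {1..s}) \<union> Inr ` {(i, i'). 1 \<le> i \<and> i < i' \<and> i' \<le> m})"
    and A2: "inj_on (\<lambda>x. case x of Inl (i, j) \<Rightarrow> \<bar>k2 i j\<bar>
                                 | Inr (i, i') \<Rightarrow> \<bar>k2 i s - k2 i' s\<bar>)
               (Inl ` ({1..m} \<times> {1..s}) \<union> Inr ` {(i, i'). 1 \<le> i \<and> i < i' \<and> i' \<le> m})"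
    and B: "\<forall>i\<in>{1..8}. \<forall>j\<in>{1..s}. sgn (k1 i j) = eps i 1 \<and> sgn (k2 i j) = eps i 2"
    and C1: "\<forall>i\<in>{1..4}. eps i 1 = 1 \<and> eps i 2 = 1"
    and C2: "\<forall>i\<in>{5..8}. eps i 1 = 1 \<and> eps i 2 = -1"
  shows "RTF F2 (generate F2 (alpha k1 k2 s ` {1..m}))"
proof -
  have s2: "2 \<le> s" using s by simp
  have "inj_on (seg_length k1 1) (seg_index m s)" "inj_on (seg_length k2 s) (seg_index m s)"
    unfolding seg_length_def[abs_def] seg_index_def by (fact A1, fact A2)
  then interpret bouquet_graph m s k1 k2
    using junction_graph_bouquet[of s m k1 k2] s2 nonzero
    by (intro bouquet_graph.intro bouquet_graph_axioms.intro)
  let ?B = "(False, (0, 0), 0)"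
  have "generate F2 (alpha k1 k2 s ` {1..m}) = {g. conn ?B g ?B}"
  proof (intro equalityI subsetI CollectI)
    fix g assume "g \<in> generate F2 (alpha k1 k2 s ` {1..m})"
    then show "conn ?B g ?B"
    proof (induction rule: generate.induct)
      case (incl h)
      then show ?case using alpha_loop by blast
    next
      case (inv h)
      then show ?case using alpha_loop conn_inv by blast
    qed (auto intro: conn_refl conn_trans)
  qed (use loop_in_generate in blast)
  then show ?thesis
    using positive_free_loops_coset by (intro RTF_F2I) simp
qed

end
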